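(* Let $\mathbf{v}\in\mathbb{R}^3$ with $|\mathbf{v}|=1$, let $\lambda\in\mathbb{R}$, and let $\Sigma$ be a compact translating $\lambda$-soliton with respect to $\mathbf{v}$ which is a graph on a domain $U$ of a plane $\Pi$ orthogonal to $\mathbf{v}$. Then $\Sigma$ is a minimizer of the weighted area $A_\phi$ in the class of all surfaces included in the cylinder $U\times\mathbb{R}\mathbf{v}=\{p+t\mathbf{v}: p\in U,\ t\in\mathbb{R}\}$ with the same boundary, the same homology class and the same weighted volume $V_\phi$ as $\Sigma$; that is, $A_\phi(\Sigma)\leq A_\phi(\widetilde\Sigma)$ for every surface $\widetilde\Sigma$ in this class.
   Context: Let $\mathbf{v}\in\mathbb{R}^3$, $|\mathbf{v}|=1$ (the density vector), and $\phi(x)=\langle x,\mathbf{v}\rangle$. The weighted area and volume elements are $dA_\phi=e^{\phi}\,dA$ and $dV_\phi=e^{\phi}\,dV$, and $A_\phi(\Sigma)=\int_\Sigma e^\phi\,dA$. An orientable surface $\Sigma\subset\mathbb{R}^3$ with Gauss map $N$ is a translating $\lambda$-soliton with respect to $\mathbf{v}$ if its mean curvature $H$ (sum of the principal curvatures, with the sign convention $H=\mathrm{trace}(-dN)$) satisfies $H=\langle N,\mathbf{v}\rangle+\lambda$. That $\Sigma$ is a graph on $U\subset\Pi$ means $\Sigma=\{p+u(p)\mathbf{v}:p\in U\}$ for a smooth function $u$ on $U$ (with $U$ including its boundary, as $\Sigma$ is compact). The competitors $\widetilde\Sigma$ are compact oriented surfaces in $U\times\mathbb{R}\mathbf{v}$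 with $\partial\widetilde\Sigma=\partial\Sigma$ which are homologous to $\Sigma$, so that $\Sigma$ and $\widetilde\Sigma$ together bound an oriented 3-chain $\Omega$ in $U\times\mathbb{R}\mathbf{v}$ (the difference of $\Sigma$ and $\widetilde\Sigma$ is $\partial\Omega$). That $\Sigma$ and $\widetilde\Sigma$ have (enclose) the same weighted volume means that the signed weighted volume $\int_\Omega dV_\phi=\int_\Omega e^{\phi}\,dV$ is zero. *)

theory Defs
  imports "HOL-Analysis.Analysis" "HOL-Homology.Homology"
begin

section \<open>Smooth maps\<close>

primrec C_k_on :: "nat \<Rightarrow> 'a::euclidean_space set \<Rightarrow> ('a \<Rightarrow> 'b::real_normed_vector) \<Rightarrow> bool" where
  "C_k_on 0 W f \<longleftrightarrow> continuous_on W f"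
| "C_k_on (Suc k) W f \<longleftrightarrow> f differentiable_on W \<and>
     (\<forall>b\<in>Basis. C_k_on k W (\<lambda>x. frechet_derivative f (at x) b))"

text \<open>On a set that need not be open (such as a domain together with its boundary), smoothness
  means the existence of a smooth extension to a neighbourhood.\<close>

definition smooth_on :: "'a::euclidean_space set \<Rightarrow> ('a \<Rightarrow> 'b::real_normed_vector) \<Rightarrow> bool" where
  "smooth_on K f \<longleftrightarrow>
     (\<exists>W g. open W \<and> K \<subseteq> W \<and> (\<forall>k. C_k_on k W g) \<and> (\<forall>x\<in>K. g x = f x))"

definition partial_deriv :: "'n \<Rightarrow> (real^'n \<Rightarrow> real^3) \<Rightarrow> real^'n \<Rightarrow> real^3" where
  "partial_deriv i g y = frechet_derivative g (at y) (axis i 1)"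

section \<open>Embedded surfaces with boundary in three-space\<close>

text \<open>Local diffeomorphisms of the ambient space flatten a surface onto the plane \<open>y$3 = 0\<close>
  near interior points, and onto the half-plane \<open>y$3 = 0\<close>, \<open>y$1 \<ge> 0\<close> near boundary points.\<close>

definition local_diffeo ::
  "(real^3) set \<Rightarrow> (real^3) set \<Rightarrow> (real^3 \<Rightarrow> real^3) \<Rightarrow> (real^3 \<Rightarrow> real^3) \<Rightarrow> bool" where
  "local_diffeo W W' F G \<longleftrightarrow>
     open W \<and> open W' \<and> homeomorphism W W' F G \<and> smooth_on W F \<and> smooth_on W' G"

definition surface_interior_point :: "(real^3) set \<Rightarrow> real^3 \<Rightarrow> bool" where
  "surface_interior_point S p \<longleftrightarrow> (\<exists>W W' F G. local_diffeo W W' F G \<and> p \<in> W \<and>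
     F ` (S \<inter> W) = {y\<in>W'. y$3 = 0})"

definition surface_boundary_point :: "(real^3) set \<Rightarrow> real^3 \<Rightarrow> bool" where
  "surface_boundary_point S p \<longleftrightarrow> (\<exists>W W' F G. local_diffeo W W' F G \<and> p \<in> W \<and>
     F ` (S \<inter> W) = {y\<in>W'. y$3 = 0 \<and> y$1 \<ge> 0} \<and> F p $ 1 = 0)"

definition smooth_surface :: "(real^3) set \<Rightarrow> bool" where
  "smooth_surface S \<longleftrightarrow> (\<forall>p\<in>S. surface_interior_point S p \<or> surface_boundary_point S p)"

definition surface_boundary :: "(real^3) set \<Rightarrow> (real^3) set" where
  "surface_boundary S = {p\<in>S. surface_boundary_point S p}"

text \<open>At a boundary point the velocities of curves starting at \<open>p\<close> and staying in \<open>S\<close> only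
  fill a half-plane; this is why the span is taken.\<close>

definition tangent_space :: "(real^3) set \<Rightarrow> real^3 \<Rightarrow> (real^3) set" where
  "tangent_space S p = span {w. \<exists>\<gamma>::real \<Rightarrow> real^3. \<gamma> 0 = p \<and> \<gamma> ` {0..1} \<subseteq> S \<and>
     (\<gamma> has_vector_derivative w) (at 0 within {0..1})}"

text \<open>An orientation is given by a Gauss map, i.e. a continuous unit normal field.\<close>

definition oriented_surface :: "(real^3) set \<Rightarrow> (real^3 \<Rightarrow> real^3) \<Rightarrow> bool" where
  "oriented_surface S N \<longleftrightarrow> smooth_surface S \<and> continuous_on S N \<and>
     (\<forall>p\<in>S. norm (N p) = 1 \<and> (\<forall>w\<in>tangent_space S p. N p \<bullet> w = 0))"

text \<open>\<open>H = trace(-dN)\<close>, the trace of the endomorphism \<open>-dN\<close> of the tangent plane being computed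
  in orthonormal bases. A derivative \<open>D\<close> of \<open>N\<close> within \<open>S\<close> is determined on the
  tangent plane only, which is all that enters.\<close>

definition has_mean_curvature ::
  "(real^3) set \<Rightarrow> (real^3 \<Rightarrow> real^3) \<Rightarrow> real^3 \<Rightarrow> real \<Rightarrow> bool" where
  "has_mean_curvature S N p H \<longleftrightarrow> (\<exists>D. (N has_derivative D) (at p within S) \<and>
     (\<forall>e1\<in>tangent_space S p. \<forall>e2\<in>tangent_space S p.
        norm e1 = 1 \<longrightarrow> norm e2 = 1 \<longrightarrow> e1 \<bullet> e2 = 0 \<longrightarrow>
        H = (- D e1) \<bullet> e1 + (- D e2) \<bullet> e2))"

definition translating_soliton ::
  "real^3 \<Rightarrow> real \<Rightarrow> (real^3) set \<Rightarrow> (real^3 \<Rightarrow> real^3) \<Rightarrow> bool" where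
  "translating_soliton v lam S N \<longleftrightarrow> oriented_surface S N \<and>
     (\<forall>p\<in>S. has_mean_curvature S N p (N p \<bullet> v + lam))"

section \<open>Weighted area\<close>

text \<open>Regular parametrizations of open pieces of \<open>S\<close>, given by domain and map.\<close>

definition patches :: "(real^3) set \<Rightarrow> ((real^2) set \<times> (real^2 \<Rightarrow> real^3)) set" where
  "patches S = {(B, \<psi>). open B \<and> smooth_on B \<psi> \<and> inj_on \<psi> B \<and> \<psi> ` B \<subseteq> S \<and>
     (\<forall>y\<in>B. cross3 (partial_deriv 1 \<psi> y) (partial_deriv 2 \<psi> y) \<noteq> 0)}"

text \<open>The integral of a nonnegative function \<open>f\<close> over \<open>S\<close> with respect to the area element
  \<open>dA = |\<psi>\<^sub>1 \<times> \<psi>\<^sub>2| dy\<^sub>1 dy\<^sub>2\<close>. Finitely many disjoint patches never exceed the integral, and they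
  exhaust a compact surface up to a null set (take the open triangles of a smooth
  triangulation), so that the supremum is the integral.\<close>

definition surface_integral :: "(real^3) set \<Rightarrow> (real^3 \<Rightarrow> real) \<Rightarrow> ennreal" where
  "surface_integral S f =
     (SUP P \<in> {P. finite P \<and> P \<subseteq> patches S \<and>
                 pairwise (\<lambda>a b. disjnt (snd a ` fst a) (snd b ` fst b)) P}.
       \<Sum>(B, \<psi>)\<in>P. \<integral>\<^sup>+y\<in>B. ennreal (f (\<psi> y) *
         norm (cross3 (partial_deriv 1 \<psi> y) (partial_deriv 2 \<psi> y))) \<partial>lborel)"

definition weighted_area :: "real^3 \<Rightarrow> (real^3) set \<Rightarrow> ennreal" where
  "weighted_area v S = surface_integral S (\<lambda>x. exp (x \<bullet> v))"

section \<open>Smooth singular chains, homology and weighted volume\<close>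

text \<open>Affine parametrizations of the standard simplices used in homology by solid simplices in
  the plane and in space; the vertex \<open>e\<^sub>0\<close> corresponds to the origin, so that the
  conventions for orienting simplices and their faces are the usual ones.\<close>

definition bary2 :: "real^2 \<Rightarrow> nat \<Rightarrow> real" where
  "bary2 y = (\<lambda>i. if i = 0 then 1 - y$1 - y$2 else if i = 1 then y$1
     else if i = 2 then y$2 else 0)"

definition bary3 :: "real^3 \<Rightarrow> nat \<Rightarrow> real" where
  "bary3 y = (\<lambda>i. if i = 0 then 1 - y$1 - y$2 - y$3 else if i = 1 then y$1
     else if i = 2 then y$2 else if i = 3 then y$3 else 0)"

definition solid_simplex2 :: "(real^2) set" where
  "solid_simplex2 = {y. bary2 y \<in> standard_simplex 2}"

definition solid_simplex3 :: "(real^3) set" where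
  "solid_simplex3 = {y. bary3 y \<in> standard_simplex 3}"

text \<open>The compact oriented surface \<open>(S, N)\<close> as a 2-chain: a relative cycle consisting of smooth
  triangles that cover \<open>S\<close> without overlapping, with coefficients \<open>\<plusminus>1\<close> that
  correct the orientation of each triangle to the one given by \<open>N\<close>. It represents the
  fundamental class of \<open>S\<close> modulo its boundary.\<close>

definition fundamental_chain ::
  "(real^3) set \<Rightarrow> (real^3 \<Rightarrow> real^3) \<Rightarrow> (real^3) chain \<Rightarrow> bool" where
  "fundamental_chain S N s \<longleftrightarrow>
     singular_relcycle 2 (top_of_set S) (surface_boundary S) s \<and>
     (\<Union>\<sigma>\<in>Poly_Mapping.keys s. \<sigma> ` standard_simplex 2) = S \<and>
     (\<forall>\<sigma>\<in>Poly_Mapping.keys s.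
        smooth_on solid_simplex2 (\<sigma> \<circ> bary2) \<and> inj_on \<sigma> (standard_simplex 2) \<and>
        Poly_Mapping.lookup s \<sigma> \<in> {1, - 1} \<and>
        (\<forall>y\<in>interior solid_simplex2. \<exists>r>0.
           of_int (Poly_Mapping.lookup s \<sigma>) *\<^sub>R
             cross3 (partial_deriv 1 (\<sigma> \<circ> bary2) y) (partial_deriv 2 (\<sigma> \<circ> bary2) y)
           = r *\<^sub>R N (\<sigma> (bary2 y)))) \<and>
     pairwise (\<lambda>\<sigma> \<tau>. disjnt ((\<sigma> \<circ> bary2) ` interior solid_simplex2)
                              ((\<tau> \<circ> bary2) ` interior solid_simplex2)) (Poly_Mapping.keys s)"

definition smooth_3_chain :: "(real^3) set \<Rightarrow> (real^3) chain \<Rightarrow> bool" where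
  "smooth_3_chain X c \<longleftrightarrow> singular_chain 3 (top_of_set X) c \<and>
     (\<forall>\<sigma>\<in>Poly_Mapping.keys c. smooth_on solid_simplex3 (\<sigma> \<circ> bary3))"

text \<open>The 3-chain \<open>\<Omega>\<close> in \<open>X\<close> is bounded by \<open>(S, N)\<close> and \<open>(S', N')\<close>:
  \<open>\<partial>\<Omega> = S - S'\<close>. Since triangulations may be chosen to agree on the common boundary of
  the two surfaces, no terms supported on that boundary are needed.\<close>

definition bounds_3_chain :: "(real^3) set \<Rightarrow> (real^3) set \<Rightarrow> (real^3 \<Rightarrow> real^3) \<Rightarrow>
    (real^3) set \<Rightarrow> (real^3 \<Rightarrow> real^3) \<Rightarrow> (real^3) chain \<Rightarrow> bool" where
  "bounds_3_chain X S N S' N' \<Omega> \<longleftrightarrow> smooth_3_chain X \<Omega> \<and>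
     (\<exists>s s'. fundamental_chain S N s \<and> fundamental_chain S' N' s' \<and>
        chain_boundary 3 \<Omega> = s - s')"

text \<open>The signed volume \<open>\<integral>\<^sub>\<Omega> e\<^sup>\<phi> dV\<close>, i.e. the integral of a 3-form over a
  smooth singular chain.\<close>

definition weighted_volume :: "real^3 \<Rightarrow> (real^3) chain \<Rightarrow> real" where
  "weighted_volume v \<Omega> = (\<Sum>\<sigma>\<in>Poly_Mapping.keys \<Omega>. of_int (Poly_Mapping.lookup \<Omega> \<sigma>) *
     integral (interior solid_simplex3) (\<lambda>y. exp (\<sigma> (bary3 y) \<bullet> v) *
       det (matrix (frechet_derivative (\<sigma> \<circ> bary3) (at y)))))"

section \<open>Graphs and competitors\<close>

text \<open>A domain, together with its boundary, of the plane \<open>\<langle>x, v\<rangle> = c\<close>.\<close>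

definition closed_plane_domain :: "real^3 \<Rightarrow> real \<Rightarrow> (real^3) set \<Rightarrow> bool" where
  "closed_plane_domain v c U \<longleftrightarrow> (\<exists>D. openin (top_of_set {x. x \<bullet> v = c}) D \<and>
     connected D \<and> D \<noteq> {} \<and> U = closure D)"

definition is_graph_on :: "real^3 \<Rightarrow> (real^3) set \<Rightarrow> (real^3) set \<Rightarrow> bool" where
  "is_graph_on v U S \<longleftrightarrow> (\<exists>u::real^3 \<Rightarrow> real. smooth_on U u \<and> S = (\<lambda>p. p + u p *\<^sub>R v) ` U)"

definition cylinder :: "real^3 \<Rightarrow> (real^3) set \<Rightarrow> (real^3) set" where
  "cylinder v U = {p + t *\<^sub>R v | p t. p \<in> U}"

definition competitor :: "real^3 \<Rightarrow> (real^3) set \<Rightarrow> (real^3) set \<Rightarrow> (real^3 \<Rightarrow> real^3) \<Rightarrow>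
    (real^3) set \<Rightarrow> (real^3 \<Rightarrow> real^3) \<Rightarrow> bool" where
  "competitor v U S N S' N' \<longleftrightarrow>
     compact S' \<and> oriented_surface S' N' \<and> S' \<subseteq> cylinder v U \<and>
     surface_boundary S' = surface_boundary S \<and>
     (\<exists>\<Omega>. bounds_3_chain (cylinder v U) S N S' N' \<Omega> \<and> weighted_volume v \<Omega> = 0)"

end

theory Submission
  imports Defs
begin

text \<open>
The proof is a calibration argument. Translate the Gauss map \<open>N\<close> of the graph along \<open>v\<close> to a
unit field \<open>X\<close> on the whole cylinder. The soliton equation says that
\<open>div X = - H = - (X \<bullet> v + \<lambda>)\<close> on the graph, hence everywhere on the cylinder, so the weighted
field \<open>Y(x) = e\<^sup>\<phi> X(x)\<close> satisfies \<open>div Y = e\<^sup>\<phi> (div X + X \<bullet> v) = - \<lambda> e\<^sup>\<phi>\<close>: the divergence of \<open>Y\<close>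
is a constant multiple of the volume weight. If the surfaces \<open>S\<close> and \<open>S'\<close> bound a chain of weighted
volume zero, Stokes' theorem therefore gives them the same flux of \<open>Y\<close>. Through \<open>S\<close>
this flux is exactly the weighted area, because \<open>Y \<bullet> N = e\<^sup>\<phi>\<close> there; through \<open>S'\<close> it is at most the
weighted area, because \<open>X\<close> has length one.

Three ingredients make this rigorous.

\<^item> Stokes' theorem for smooth singular 3-chains (\<open>stokes_smooth_chain\<close>). The flux form is pulled
  back to the standard simplex, where its divergence is computed with the symmetry of second
  derivatives (\<open>piola_identity\<close>) and integrated by Fubini and the fundamental theorem of
  calculus (\<open>divergence_theorem_simplex\<close>).

\<^item> The comparison of flux and area. A triangulation is one of the families of patches over
  which the supremum defining the area is taken, so for any surface the sum of the areas of the triangles is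
  at most the area (\<open>chain_flux_le_surface_integral\<close>). For the graph the converse inequality holds as
  well (\<open>surface_integral_le_chain_flux\<close>). There every patch can be measured by its projection
  to the plane, with density \<open>e\<^sup>\<phi> / |N \<bullet> v|\<close>; projections of disjoint patches are disjoint, and the triangles
  cover the projection of \<open>S\<close> up to a null set.

\<^item> The field \<open>X\<close> (\<open>translated_gauss_map\<close>). It is built from a smooth extension of the height
  function, so that it is continuously differentiable on a neighbourhood of the cylinder. The
  identities linking it with \<open>N\<close> and \<open>H\<close> are proved over the open part of the domain, where
  the tangent planes are known, and pass to the boundary by continuity.
\<close>

section \<open>Continuously differentiable maps\<close>

lemma linear_basis_expansion:
  fixes L :: "'a::euclidean_space \<Rightarrow> 'b::real_vector"
  assumes "linear L"
  shows "L k = (\<Sum>b\<in>Basis. (k \<bullet> b) *\<^sub>R L b)"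
  by (subst euclidean_representation[of k, symmetric])
    (simp only: linear_sum[OF assms] linear_cmul[OF assms])

text \<open>The derivative is kept as an explicit second argument, so that derivatives of composed
  maps are read off from the rules below and never have to be recovered from a choice operator.\<close>

definition C1_on :: "'a::euclidean_space set \<Rightarrow> ('a \<Rightarrow> 'b::real_normed_vector) \<Rightarrow> ('a \<Rightarrow> 'a \<Rightarrow> 'b) \<Rightarrow> bool" where
  "C1_on W f f' \<longleftrightarrow> open W \<and> (\<forall>x\<in>W. (f has_derivative f' x) (at x)) \<and>
     (\<forall>h. continuous_on W (\<lambda>x. f' x h))"

lemma C1_onD:
  assumes "C1_on W f f'"
  shows "open W" "x \<in> W \<Longrightarrow> (f has_derivative f' x) (at x)" "continuous_on W (\<lambda>x. f' x h)"
    "continuous_on W f" "x \<in> W \<Longrightarrow> linear (f' x)"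
proof -
  show 1: "open W" "x \<in> W \<Longrightarrow> (f has_derivative f' x) (at x)" "continuous_on W (\<lambda>x. f' x h)" for x
    using assms by (auto simp: C1_on_def)
  show "continuous_on W f"
    using 1(2) by (meson continuous_at_imp_continuous_on has_derivative_continuous)
  show "x \<in> W \<Longrightarrow> linear (f' x)"
    using 1(2) has_derivative_linear by blast
qed

lemma C1_on_subset: "C1_on W f f' \<Longrightarrow> open V \<Longrightarrow> V \<subseteq> W \<Longrightarrow> C1_on V f f'"
  unfolding C1_on_def by (meson continuous_on_subset subsetD)

lemma C1_on_cong:
  assumes "C1_on W f f'" "\<And>x. x \<in> W \<Longrightarrow> f x = g x" "\<And>x h. x \<in> W \<Longrightarrow> f' x h = g' x h"
  shows "C1_on W g g'"
proof -
  have "(g has_derivative g' x) (at x)" if "x \<in> W" for x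
  proof -
    have "f' x = g' x" using assms(3) that by auto
    then show ?thesis
      using has_derivative_transform_within_open[OF C1_onD(2)[OF assms(1) that] C1_onD(1)[OF assms(1)] that]
        assms(2) by auto
  qed
  moreover have "continuous_on W (\<lambda>x. g' x h)" for h
    by (rule continuous_on_eq[OF C1_onD(3)[OF assms(1), of h]]) (simp add: assms(3))
  ultimately show ?thesis
    using C1_onD(1)[OF assms(1)] by (auto simp: C1_on_def)
qed

lemma C1_on_const: "open W \<Longrightarrow> C1_on W (\<lambda>x. k) (\<lambda>x h. 0)"
  by (auto simp: C1_on_def)

lemma C1_on_bounded_linear:
  assumes "bounded_linear L" "C1_on W f f'"
  shows "C1_on W (\<lambda>x. L (f x)) (\<lambda>x h. L (f' x h))"
  using assms bounded_linear.has_derivative[OF assms(1)]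
  unfolding C1_on_def by (auto intro: bounded_linear.continuous_on)

lemma C1_on_add:
  "C1_on W f f' \<Longrightarrow> C1_on W g g' \<Longrightarrow> C1_on W (\<lambda>x. f x + g x) (\<lambda>x h. f' x h + g' x h)"
  unfolding C1_on_def by (auto intro!: derivative_intros continuous_intros)

lemma C1_on_sum:
  assumes "open W" "\<And>i. i \<in> I \<Longrightarrow> C1_on W (f i) (f' i)"
  shows "C1_on W (\<lambda>x. \<Sum>i\<in>I. f i x) (\<lambda>x h. \<Sum>i\<in>I. f' i x h)"
  using assms unfolding C1_on_def
  by (auto intro!: has_derivative_sum continuous_on_sum)

lemma (in bounded_bilinear) C1_on:
  assumes "C1_on W f f'" "C1_on W g g'"
  shows "C1_on W (\<lambda>x. prod (f x) (g x)) (\<lambda>x h. prod (f x) (g' x h) + prod (f' x h) (g x))"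
  using assms C1_onD(4)[OF assms(1)] C1_onD(4)[OF assms(2)]
  unfolding C1_on_def by (auto intro!: FDERIV continuous_on continuous_on_add)

text \<open>Continuity of the derivative is only known direction by direction; since the inner direction
  \<open>f' x h\<close> varies with \<open>x\<close>, it has to be expanded in a fixed basis.\<close>

lemma C1_on_compose:
  fixes f :: "'a::euclidean_space \<Rightarrow> 'b::euclidean_space"
  assumes "C1_on W f f'" "C1_on V g g'" "f ` W \<subseteq> V"
  shows "C1_on W (\<lambda>x. g (f x)) (\<lambda>x h. g' (f x) (f' x h))"
proof -
  have lin: "g' (f x) k = (\<Sum>b\<in>Basis. (k \<bullet> b) *\<^sub>R g' (f x) b)" if "x \<in> W" for x k
  proof -
    have "linear (g' (f x))"
      using assms that by (meson C1_onD(5) image_subset_iff)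
    then show ?thesis
      by (rule linear_basis_expansion)
  qed
  have "continuous_on W (\<lambda>x. \<Sum>b\<in>Basis. (f' x h \<bullet> b) *\<^sub>R g' (f x) b)" for h
    using C1_onD(3)[OF assms(1)] continuous_on_compose2[OF C1_onD(3)[OF assms(2)] C1_onD(4)[OF assms(1)] assms(3)]
    by (intro continuous_intros)
  then have "continuous_on W (\<lambda>x. g' (f x) (f' x h))" for h
    by (rule continuous_on_eq) (rule lin[symmetric])
  moreover have "((\<lambda>x. g (f x)) has_derivative (\<lambda>h. g' (f x) (f' x h))) (at x)" if "x \<in> W" for x
    using has_derivative_compose[OF C1_onD(2)[OF assms(1) that], of g "g' (f x)"]
      C1_onD(2)[OF assms(2)] assms(3) that by auto
  ultimately show ?thesis
    using C1_onD(1)[OF assms(1)] by (auto simp: C1_on_def)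
qed

lemma C_k_on_Suc_imp_C1_on:
  assumes W: "open W" and f: "C_k_on (Suc k) W f"
  shows "C1_on W f (\<lambda>x. frechet_derivative f (at x))"
proof -
  have d: "(f has_derivative frechet_derivative f (at x)) (at x)" if "x \<in> W" for x
  proof -
    have "f differentiable_on W" using f by simp
    then have "f differentiable (at x)"
      using W that unfolding differentiable_on_def by (metis at_within_open)
    then show ?thesis by (rule iffD1[OF frechet_derivative_works])
  qed
  have ck: "C_k_on k W g \<Longrightarrow> continuous_on W g" for g :: "'a \<Rightarrow> 'b"
    by (cases k) (auto intro: differentiable_imp_continuous_on)
  have "continuous_on W (\<lambda>x. frechet_derivative f (at x) h)" for h
  proof -
    have "continuous_on W (\<lambda>x. \<Sum>b\<in>Basis. (h \<bullet> b) *\<^sub>R frechet_derivative f (at x) b)"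
      using f ck by (intro continuous_intros) auto
    then show ?thesis
      by (rule continuous_on_eq)
        (rule linear_basis_expansion[OF has_derivative_linear[OF d], symmetric])
  qed
  with d W show ?thesis by (auto simp: C1_on_def)
qed

lemma C_k_on_2_imp_C1_on_derivative:
  assumes W: "open W" and f: "C_k_on 2 W f"
  shows "\<exists>f''. \<forall>h. C1_on W (\<lambda>x. frechet_derivative f (at x) h) (\<lambda>x. f'' x h)"
proof -
  let ?F = "\<lambda>x. frechet_derivative f (at x)"
  have f1: "C_k_on (Suc (Suc 0)) W f" using f by (simp add: numeral_2_eq_2)
  have 1: "C1_on W f ?F" by (rule C_k_on_Suc_imp_C1_on[OF W f1])
  have b: "C1_on W (\<lambda>x. ?F x b) (\<lambda>x. frechet_derivative (\<lambda>x. ?F x b) (at x))" if "b \<in> Basis" for b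
    using f1 that by (intro C_k_on_Suc_imp_C1_on[OF W, of 0]) auto
  have "C1_on W (\<lambda>x. ?F x h)
     (\<lambda>x k. \<Sum>b\<in>Basis. (h \<bullet> b) *\<^sub>R frechet_derivative (\<lambda>x. ?F x b) (at x) k)" for h
  proof (rule C1_on_cong)
    show "C1_on W (\<lambda>x. \<Sum>b\<in>Basis. (h \<bullet> b) *\<^sub>R ?F x b)
       (\<lambda>x k. \<Sum>b\<in>Basis. (h \<bullet> b) *\<^sub>R frechet_derivative (\<lambda>x. ?F x b) (at x) k)"
      by (rule C1_on_sum[OF W], rule C1_on_bounded_linear[OF bounded_linear_scaleR_right], rule b)
    show "(\<Sum>b\<in>Basis. (h \<bullet> b) *\<^sub>R ?F x b) = ?F x h" if "x \<in> W" for x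
      by (rule linear_basis_expansion[OF C1_onD(5)[OF 1 that], symmetric])
  qed simp
  then show ?thesis
    by (intro exI[of _ "\<lambda>x h k. \<Sum>b\<in>Basis. (h \<bullet> b) *\<^sub>R frechet_derivative (\<lambda>x. ?F x b) (at x) k"]) blast
qed

text \<open>Two applications of the mean value theorem write the mixed difference of \<open>f\<close> over a small
  parallelogram as a value of the mixed derivative.\<close>

lemma mixed_difference:
  fixes f :: "'a::euclidean_space \<Rightarrow> real"
  assumes f: "C1_on W f f'" and fa: "C1_on W (\<lambda>x. f' x a) (\<lambda>x. f'' x a)"
    and W: "\<And>s t. 0 \<le> s \<Longrightarrow> s \<le> e \<Longrightarrow> 0 \<le> t \<Longrightarrow> t \<le> e \<Longrightarrow> x + s *\<^sub>R a + t *\<^sub>R b \<in> W" and e: "0 < e"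
  shows "\<exists>s t. 0 < s \<and> s < e \<and> 0 < t \<and> t < e \<and>
     f (x + e *\<^sub>R a + e *\<^sub>R b) - f (x + e *\<^sub>R a) - f (x + e *\<^sub>R b) + f x
       = e * e * f'' (x + s *\<^sub>R a + t *\<^sub>R b) a b"
proof -
  let ?p = "\<lambda>s. f (x + s *\<^sub>R a + e *\<^sub>R b) - f (x + s *\<^sub>R a + 0 *\<^sub>R b)"
  have dp: "(?p has_real_derivative
      f' (x + s *\<^sub>R a + e *\<^sub>R b) a - f' (x + s *\<^sub>R a + 0 *\<^sub>R b) a) (at s)" if "0 \<le> s" "s \<le> e" for s
  proof -
    have "((\<lambda>s. f (x + s *\<^sub>R a + t *\<^sub>R b)) has_real_derivative f' (x + s *\<^sub>R a + t *\<^sub>R b) a) (at s)"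
      if t: "0 \<le> t" "t \<le> e" for t
    proof -
      have w: "x + s *\<^sub>R a + t *\<^sub>R b \<in> W" using W \<open>0 \<le> s\<close> \<open>s \<le> e\<close> t by auto
      have "((\<lambda>s. f (x + s *\<^sub>R a + t *\<^sub>R b)) has_derivative
         (\<lambda>h. f' (x + s *\<^sub>R a + t *\<^sub>R b) (h *\<^sub>R a))) (at s)"
        by (rule has_derivative_compose[where f = "\<lambda>s. x + s *\<^sub>R a + t *\<^sub>R b", OF _ C1_onD(2)[OF f w]]) (auto intro!: derivative_eq_intros)
      then show ?thesis
        by (rule has_derivative_imp_has_field_derivative)
          (simp add: linear_cmul[OF C1_onD(5)[OF f w]])
    qed
    from this[of e] this[of 0] e show ?thesis
      by (intro DERIV_diff) auto
  qed
  have "\<exists>s>0. s < e \<and> ?p e - ?p 0 = (e - 0) * (f' (x + s *\<^sub>R a + e *\<^sub>R b) a - f' (x + s *\<^sub>R a + 0 *\<^sub>R b) a)"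
    by (rule MVT2[OF e dp])
  then obtain s where s: "0 < s" "s < e"
    "?p e - ?p 0 = e * (f' (x + s *\<^sub>R a + e *\<^sub>R b) a - f' (x + s *\<^sub>R a + 0 *\<^sub>R b) a)" by auto
  have dq: "((\<lambda>t. f' (x + s *\<^sub>R a + t *\<^sub>R b) a) has_real_derivative f'' (x + s *\<^sub>R a + t *\<^sub>R b) a b) (at t)"
    if t: "0 \<le> t" "t \<le> e" for t
  proof -
    have w: "x + s *\<^sub>R a + t *\<^sub>R b \<in> W" using W s t by auto
    have "((\<lambda>t. f' (x + s *\<^sub>R a + t *\<^sub>R b) a) has_derivative
         (\<lambda>h. f'' (x + s *\<^sub>R a + t *\<^sub>R b) a (h *\<^sub>R b))) (at t)"
      by (rule has_derivative_compose[where f = "\<lambda>t. x + s *\<^sub>R a + t *\<^sub>R b", OF _ C1_onD(2)[OF fa w]]) (auto intro!: derivative_eq_intros)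
    then show ?thesis
      by (rule has_derivative_imp_has_field_derivative)
        (simp add: linear_cmul[OF C1_onD(5)[OF fa w]])
  qed
  have "\<exists>t>0. t < e \<and> f' (x + s *\<^sub>R a + e *\<^sub>R b) a - f' (x + s *\<^sub>R a + 0 *\<^sub>R b) a
      = (e - 0) * f'' (x + s *\<^sub>R a + t *\<^sub>R b) a b"
    by (rule MVT2[OF e dq])
  then obtain t where t: "0 < t" "t < e"
    "f' (x + s *\<^sub>R a + e *\<^sub>R b) a - f' (x + s *\<^sub>R a + 0 *\<^sub>R b) a = e * f'' (x + s *\<^sub>R a + t *\<^sub>R b) a b" by auto
  have "f (x + e *\<^sub>R a + e *\<^sub>R b) - f (x + e *\<^sub>R a) - f (x + e *\<^sub>R b) + f x
       = e * e * f'' (x + s *\<^sub>R a + t *\<^sub>R b) a b"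
    using s(3) unfolding t(3) by simp
  with s t show ?thesis by blast
qed

text \<open>The mixed difference is symmetric in \<open>a\<close> and \<open>b\<close>, and after division by the area of the
  parallelogram it tends to either of the two mixed derivatives.\<close>

lemma second_derivative_symmetric_real:
  fixes f :: "'a::euclidean_space \<Rightarrow> real"
  assumes f: "C1_on W f f'" and f'': "\<And>h. C1_on W (\<lambda>x. f' x h) (\<lambda>x. f'' x h)" and x: "x \<in> W"
  shows "f'' x a b = f'' x b a"
proof -
  obtain d where d: "d > 0" "ball x d \<subseteq> W"
    using C1_onD(1)[OF f] x by (meson openE)
  \<comment> \<open>a parallelogram with scale \<open>r / c\<close> stays inside the ball of radius \<open>r\<close>\<close>
  define c where "c = norm a + norm b + 1"
  have c: "c > 0" by (simp add: c_def add_nonneg_pos)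
  have near: "dist (x + s *\<^sub>R a' + t *\<^sub>R b') x < r"
    if "0 \<le> s" "s \<le> r/c" "0 \<le> t" "t \<le> r/c" "r > 0" "{a', b'} = {a, b}" for s t r and a' b'
  proof -
    have "dist (x + s *\<^sub>R a' + t *\<^sub>R b') x \<le> norm (s *\<^sub>R a') + norm (t *\<^sub>R b')"
      using norm_triangle_ineq[of "s *\<^sub>R a'" "t *\<^sub>R b'"] by (simp only: dist_norm add.assoc add_diff_cancel_left')
    also have "\<dots> \<le> r/c * norm a' + r/c * norm b'"
      unfolding norm_scaleR using that by (intro add_mono mult_right_mono) auto
    also have "\<dots> \<le> r/c * (norm a + norm b)"
      using that(5,6) c by (auto simp: doubleton_eq_iff algebra_simps)
    also have "\<dots> < r/c * c"
      using that c by (intro mult_strict_left_mono) (auto simp: c_def)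
    finally show ?thesis using c by simp
  qed
  have lim: "\<bar>f'' x a b - f'' x b a\<bar> \<le> k" if k: "k > 0" for k
  proof -
    have co: "\<exists>r>0. \<forall>y. dist y x < r \<longrightarrow> y \<in> W \<and> dist (f'' y h l) (f'' x h l) < k/2" for h l
    proof -
      have "isCont (\<lambda>x. f'' x h l) x"
        using C1_onD(1,3)[OF f''[of h]] x continuous_on_eq_continuous_at by blast
      then obtain r where "r > 0" "\<forall>y. dist y x < r \<longrightarrow> dist (f'' y h l) (f'' x h l) < k/2"
        using k unfolding continuous_at_eps_delta by (metis half_gt_zero)
      with d show ?thesis by (intro exI[of _ "min r d"]) (auto simp: dist_commute)
    qed
    obtain r1 where r1: "r1 > 0" "\<And>y. dist y x < r1 \<Longrightarrow> y \<in> W \<and> dist (f'' y a b) (f'' x a b) < k/2"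
      using co by meson
    obtain r2 where r2: "r2 > 0" "\<And>y. dist y x < r2 \<Longrightarrow> y \<in> W \<and> dist (f'' y b a) (f'' x b a) < k/2"
      using co by meson
    define r where "r = min r1 r2"
    define e where "e = r/c"
    have r: "r > 0" and e: "e > 0" using r1 r2 c by (auto simp: r_def e_def)
    have W1: "x + s *\<^sub>R a + t *\<^sub>R b \<in> W" if "0 \<le> s" "s \<le> e" "0 \<le> t" "t \<le> e" for s t
      using near[OF that(1) _ that(3), of r a b] that r r1(2) by (auto simp: e_def r_def)
    have W2: "x + s *\<^sub>R b + t *\<^sub>R a \<in> W" if "0 \<le> s" "s \<le> e" "0 \<le> t" "t \<le> e" for s t
      using near[OF that(1) _ that(3), of r b a] that r r1(2) by (auto simp: e_def r_def)
    obtain s t where 1: "0 < s" "s < e" "0 < t" "t < e"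
      "f (x + e *\<^sub>R a + e *\<^sub>R b) - f (x + e *\<^sub>R a) - f (x + e *\<^sub>R b) + f x
         = e * e * f'' (x + s *\<^sub>R a + t *\<^sub>R b) a b"
      using mixed_difference[OF f f'' _ e, where x=x and a=a and b=b] W1 by blast
    obtain s' t' where 2: "0 < s'" "s' < e" "0 < t'" "t' < e"
      "f (x + e *\<^sub>R b + e *\<^sub>R a) - f (x + e *\<^sub>R b) - f (x + e *\<^sub>R a) + f x
         = e * e * f'' (x + s' *\<^sub>R b + t' *\<^sub>R a) b a"
      using mixed_difference[OF f f'' _ e, where x=x and a=b and b=a] W2 by blast
    have comm: "x + e *\<^sub>R b + e *\<^sub>R a = x + e *\<^sub>R a + e *\<^sub>R b" by simp
    from 1(5) 2(5)[unfolded comm] have "e * e * f'' (x + s *\<^sub>R a + t *\<^sub>R b) a b = e * e * f'' (x + s' *\<^sub>R b + t' *\<^sub>R a) b a"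
      by linarith
    then have eq: "f'' (x + s *\<^sub>R a + t *\<^sub>R b) a b = f'' (x + s' *\<^sub>R b + t' *\<^sub>R a) b a"
      using e by simp
    have "dist (x + s *\<^sub>R a + t *\<^sub>R b) x < r" using near 1 r by (auto simp: e_def)
    then have "dist (f'' (x + s *\<^sub>R a + t *\<^sub>R b) a b) (f'' x a b) < k/2" using r1(2) by (auto simp: r_def)
    moreover have "dist (x + s' *\<^sub>R b + t' *\<^sub>R a) x < r" using near[of s' r t' b a] 2(1-4) r by (auto simp: e_def)
    then have "dist (f'' (x + s' *\<^sub>R b + t' *\<^sub>R a) b a) (f'' x b a) < k/2" using r2(2) by (auto simp: r_def)
    ultimately show ?thesis using eq unfolding dist_real_def by linarith
  qed
  have "\<bar>f'' x a b - f'' x b a\<bar> \<le> 0"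
    by (rule field_le_epsilon) (use lim in auto)
  then show ?thesis by simp
qed

lemma second_derivative_symmetric:
  fixes f :: "'a::euclidean_space \<Rightarrow> 'b::euclidean_space"
  assumes f: "C1_on W f f'" and f'': "\<And>h. C1_on W (\<lambda>x. f' x h) (\<lambda>x. f'' x h)" and x: "x \<in> W"
  shows "f'' x a b = f'' x b a"
proof (rule euclidean_eqI)
  fix i :: 'b
  show "f'' x a b \<bullet> i = f'' x b a \<bullet> i"
    using second_derivative_symmetric_real[of W "\<lambda>x. f x \<bullet> i" "\<lambda>x h. f' x h \<bullet> i" "\<lambda>x h k. f'' x h k \<bullet> i" x a b]
      C1_on_bounded_linear[OF bounded_linear_inner_left f] C1_on_bounded_linear[OF bounded_linear_inner_left f''] x
    by auto
qed

section \<open>The pull-back of a vector field\<close>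

text \<open>The components of the flux form of \<open>Y\<close> pulled back by \<open>g\<close>, viewed as a vector field. Indices
  are added modulo 3, which makes the three components cyclic permutations of each other.\<close>

definition pullback_field :: "(real^3 \<Rightarrow> real^3) \<Rightarrow> (real^3 \<Rightarrow> real^3) \<Rightarrow> (real^3 \<Rightarrow> real^3 \<Rightarrow> real^3) \<Rightarrow> 3 \<Rightarrow> real^3 \<Rightarrow> real" where
  "pullback_field Y g g' i y = Y (g y) \<bullet> cross3 (g' y (axis (i + 1) 1)) (g' y (axis (i + 2) 1))"

definition divergence :: "(real^3 \<Rightarrow> real^3 \<Rightarrow> real^3) \<Rightarrow> real^3 \<Rightarrow> real" where
  "divergence Y' x = (\<Sum>i\<in>UNIV. Y' x (axis i 1) $ i)"

text \<open>Both sides are alternating and trilinear in \<open>a\<close>, \<open>b\<close>, \<open>c\<close>; this is the derivative at the identity of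
  the multiplicativity of the determinant.\<close>

lemma trace_cross_identity:
  fixes L :: "real^3 \<Rightarrow> real^3"
  assumes "linear L"
  shows "L a \<bullet> cross3 b c + L b \<bullet> cross3 c a + L c \<bullet> cross3 a b
    = (\<Sum>i\<in>UNIV. L (axis i 1) $ i) * (a \<bullet> cross3 b c)"
proof -
  have L: "L x = x$1 *\<^sub>R L (axis 1 1) + x$2 *\<^sub>R L (axis 2 1) + x$3 *\<^sub>R L (axis 3 1)" for x
  proof -
    have "x = x$1 *\<^sub>R axis 1 1 + x$2 *\<^sub>R axis 2 1 + x$3 *\<^sub>R (axis 3 1 :: real^3)"
      by (simp add: vec_eq_iff forall_3 axis_def)
    then have "L x = L (x$1 *\<^sub>R axis 1 1 + x$2 *\<^sub>R axis 2 1 + x$3 *\<^sub>R axis 3 1)"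
      by (rule arg_cong)
    then show ?thesis
      by (simp only: linear_add[OF assms] linear_cmul[OF assms])
  qed
  show ?thesis
    unfolding L[of a] L[of b] L[of c] by (simp add: cross3_simps)
qed

text \<open>The terms containing second derivatives of \<open>g\<close> cancel in pairs, because mixed derivatives
  commute and the cross product is skew; the remaining terms are a trace.\<close>

lemma piola_identity:
  fixes g :: "real^3 \<Rightarrow> real^3" and Y :: "real^3 \<Rightarrow> real^3"
  assumes g: "C1_on W g g'" and g'': "\<And>h. C1_on W (\<lambda>x. g' x h) (\<lambda>x. g'' x h)"
    and Y: "C1_on V Y Y'" and V: "g ` W \<subseteq> V"
  shows "\<exists>Z'. (\<forall>i. C1_on W (pullback_field Y g g' i) (Z' i)) \<and>
     (\<forall>x\<in>W. (\<Sum>i\<in>UNIV. Z' i x (axis i 1)) = divergence Y' (g x) * det (matrix (g' x)))"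
proof -
  define a where "a i = (axis i 1 :: real^3)" for i
  define Z' where "Z' i x h = Y (g x) \<bullet> (cross3 (g' x (a (i+1))) (g'' x (a (i+2)) h)
     + cross3 (g'' x (a (i+1)) h) (g' x (a (i+2))))
     + Y' (g x) (g' x h) \<bullet> cross3 (g' x (a (i+1))) (g' x (a (i+2)))" for i x h
  have bil: "bounded_bilinear cross3"
    using bilinear_cross bilinear_conv_bounded_bilinear by blast
  have "C1_on W (pullback_field Y g g' i) (Z' i)" for i
    unfolding pullback_field_def Z'_def a_def[symmetric]
    by (intro bounded_bilinear.C1_on[OF bounded_bilinear_inner] C1_on_compose[OF g Y V]
        bounded_bilinear.C1_on[OF bil] g'')
  moreover have "(\<Sum>i\<in>UNIV. Z' i x (axis i 1)) = divergence Y' (g x) * det (matrix (g' x))" if x: "x \<in> W" for x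
  proof -
    have ar: "(2::3) + 2 = 1" "(3::3) + 1 = 1" "(3::3) + 2 = 2" "(1::3) + 2 = 3" "(2::3)+1 = 3" "(1::3)+1 = 2"
      by auto
    note sym = second_derivative_symmetric[OF g g'' x]
    have skew: "cross3 p q = - cross3 q p" for p q by (rule cross_skew)
    have lin: "linear (Y' (g x))" using Y V x C1_onD(5) by blast
    have zero: "cross3 (g' x (a 2)) (g'' x (a 3) (a 1)) + cross3 (g'' x (a 2) (a 1)) (g' x (a 3))
       + (cross3 (g' x (a 3)) (g'' x (a 1) (a 2)) + cross3 (g'' x (a 3) (a 2)) (g' x (a 1)))
       + (cross3 (g' x (a 1)) (g'' x (a 2) (a 3)) + cross3 (g'' x (a 1) (a 3)) (g' x (a 2))) = 0"
      using skew[of "g' x (a 2)" "g'' x (a 3) (a 1)"] skew[of "g' x (a 3)" "g'' x (a 1) (a 2)"]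
        skew[of "g' x (a 1)" "g'' x (a 2) (a 3)"] sym[of "a 1" "a 2"] sym[of "a 1" "a 3"] sym[of "a 2" "a 3"]
      by simp
    have "(\<Sum>i\<in>UNIV. Z' i x (axis i 1)) = Y (g x) \<bullet> (cross3 (g' x (a 2)) (g'' x (a 3) (a 1)) + cross3 (g'' x (a 2) (a 1)) (g' x (a 3))
       + (cross3 (g' x (a 3)) (g'' x (a 1) (a 2)) + cross3 (g'' x (a 3) (a 2)) (g' x (a 1)))
       + (cross3 (g' x (a 1)) (g'' x (a 2) (a 3)) + cross3 (g'' x (a 1) (a 3)) (g' x (a 2))))
       + (Y' (g x) (g' x (a 1)) \<bullet> cross3 (g' x (a 2)) (g' x (a 3)) + Y' (g x) (g' x (a 2)) \<bullet> cross3 (g' x (a 3)) (g' x (a 1))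
       + Y' (g x) (g' x (a 3)) \<bullet> cross3 (g' x (a 1)) (g' x (a 2)))"
      unfolding sum_3 Z'_def a_def[symmetric] ar by (simp only: inner_add_right ac_simps)
    also have "\<dots> = divergence Y' (g x) * (g' x (a 1) \<bullet> cross3 (g' x (a 2)) (g' x (a 3)))"
      unfolding zero trace_cross_identity[OF lin] divergence_def by simp
    also have "g' x (a 1) \<bullet> cross3 (g' x (a 2)) (g' x (a 3)) = det (matrix (g' x))"
      by (simp add: cross3_simps matrix_def a_def)
    finally show ?thesis .
  qed
  ultimately show ?thesis by blast
qed

section \<open>The divergence theorem on the standard simplex\<close>

lemma mem_solid_simplex2: "y \<in> solid_simplex2 \<longleftrightarrow> 0 \<le> y$1 \<and> 0 \<le> y$2 \<and> y$1 + y$2 \<le> 1"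
proof
  assume "y \<in> solid_simplex2"
  then have "0 \<le> bary2 y i" for i by (simp add: solid_simplex2_def standard_simplex_def)
  from this[of 0] this[of 1] this[of 2] show "0 \<le> y$1 \<and> 0 \<le> y$2 \<and> y$1 + y$2 \<le> 1"
    by (simp add: bary2_def)
next
  assume "0 \<le> y$1 \<and> 0 \<le> y$2 \<and> y$1 + y$2 \<le> 1"
  moreover have "(\<Sum>i\<le>2. bary2 y i) = 1" by (simp add: numeral_2_eq_2 bary2_def)
  ultimately show "y \<in> solid_simplex2"
    by (simp add: solid_simplex2_def standard_simplex_def) (simp add: bary2_def)
qed

lemma mem_solid_simplex3: "y \<in> solid_simplex3 \<longleftrightarrow> 0 \<le> y$1 \<and> 0 \<le> y$2 \<and> 0 \<le> y$3 \<and> y$1 + y$2 + y$3 \<le> 1"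
proof
  assume "y \<in> solid_simplex3"
  then have "0 \<le> bary3 y i" for i by (simp add: solid_simplex3_def standard_simplex_def)
  from this[of 0] this[of 1] this[of 2] this[of 3]
  show "0 \<le> y$1 \<and> 0 \<le> y$2 \<and> 0 \<le> y$3 \<and> y$1 + y$2 + y$3 \<le> 1"
    by (simp add: bary3_def)
next
  assume "0 \<le> y$1 \<and> 0 \<le> y$2 \<and> 0 \<le> y$3 \<and> y$1 + y$2 + y$3 \<le> 1"
  moreover have "(\<Sum>i\<le>3. bary3 y i) = 1" by (simp add: numeral_2_eq_2 numeral_3_eq_3 bary3_def)
  ultimately show "y \<in> solid_simplex3"
    by (simp add: solid_simplex3_def standard_simplex_def) (simp add: bary3_def)
qed

lemma vector_2_axis: "(vector [a, b] :: real^2) = a *\<^sub>R axis 1 1 + b *\<^sub>R axis 2 1"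
  by (simp add: vec_eq_iff forall_2 axis_def)

lemma vector_3_axis: "(vector [a, b, c] :: real^3) = a *\<^sub>R axis 1 1 + b *\<^sub>R axis 2 1 + c *\<^sub>R axis 3 1"
  by (simp add: vec_eq_iff forall_3 axis_def)

lemma continuous_on_vector_3:
  "continuous_on A a \<Longrightarrow> continuous_on A b \<Longrightarrow> continuous_on A c \<Longrightarrow>
    continuous_on A (\<lambda>x. vector [a x, b x, c x] :: real^3)"
  unfolding vector_3_axis by (intro continuous_intros)

lemma compact_solid_simplex2: "compact solid_simplex2"
proof -
  have eq: "solid_simplex2 = {y. 0 \<le> y$1} \<inter> {y. 0 \<le> y$2} \<inter> {y. y$1 + y$2 \<le> 1}"
    by (auto simp: mem_solid_simplex2)
  have "closed solid_simplex2"
    unfolding eq by (intro closed_Int closed_Collect_le continuous_intros)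
  moreover have "solid_simplex2 \<subseteq> cbox 0 1"
    by (auto simp: mem_solid_simplex2 mem_box_cart forall_2)
  ultimately show ?thesis
    by (meson bounded_cbox bounded_subset compact_eq_bounded_closed)
qed

lemma compact_solid_simplex3: "compact solid_simplex3"
proof -
  have eq: "solid_simplex3 = {y. 0 \<le> y$1} \<inter> {y. 0 \<le> y$2} \<inter> {y. 0 \<le> y$3} \<inter> {y. y$1 + y$2 + y$3 \<le> 1}"
    by (auto simp: mem_solid_simplex3)
  have "closed solid_simplex3"
    unfolding eq by (intro closed_Int closed_Collect_le continuous_intros)
  moreover have "solid_simplex3 \<subseteq> cbox 0 1"
    by (auto simp: mem_solid_simplex3 mem_box_cart forall_3)
  ultimately show ?thesis
    by (meson bounded_cbox bounded_subset compact_eq_bounded_closed)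
qed

lemma convex_solid_simplex2: "convex solid_simplex2"
proof -
  have eq: "solid_simplex2 = {y. 0 \<le> axis 1 1 \<bullet> y} \<inter> {y. 0 \<le> axis 2 1 \<bullet> y} \<inter> {y. (axis 1 1 + axis 2 1) \<bullet> y \<le> 1}"
    by (auto simp: mem_solid_simplex2 inner_axis' inner_add_left)
  show ?thesis
    unfolding eq by (intro convex_Int convex_halfspace_le convex_halfspace_ge)
qed

lemma convex_solid_simplex3: "convex solid_simplex3"
proof -
  have eq: "solid_simplex3 = {y. 0 \<le> axis 1 1 \<bullet> y} \<inter> {y. 0 \<le> axis 2 1 \<bullet> y} \<inter> {y. 0 \<le> axis 3 1 \<bullet> y}
      \<inter> {y. (axis 1 1 + axis 2 1 + axis 3 1) \<bullet> y \<le> 1}"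
    by (auto simp: mem_solid_simplex3 inner_axis' inner_add_left)
  show ?thesis
    unfolding eq by (intro convex_Int convex_halfspace_le convex_halfspace_ge)
qed

lemma integral_interior_convex:
  fixes f :: "'a::euclidean_space \<Rightarrow> real"
  assumes "convex T"
  shows "integral (interior T) f = integral T f"
proof (rule integral_subset_negligible[OF interior_subset])
  show "negligible (T - interior T)"
    using negligible_convex_frontier[OF assms]
    by (rule negligible_subset) (use closure_subset in \<open>auto simp: frontier_def\<close>)
qed

lemma set_integrable_lborel_compact:
  fixes f :: "'a::euclidean_space \<Rightarrow> real"
  assumes "compact T" "continuous_on T f"
  shows "set_integrable lborel T f"
  using borel_integrable_compact[OF assms] by (simp add: set_integrable_def)

lemma absolutely_integrable_on_compact:
  fixes f :: "'a::euclidean_space \<Rightarrow> real"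
  assumes "compact T" "continuous_on T f"
  shows "f absolutely_integrable_on T"
  using borel_integrable_compact[OF assms] unfolding set_integrable_def
  by (subst integrable_completion) (auto dest: borel_measurable_integrable)

lemma prod_UNIV_2: "prod f (UNIV :: 2 set) = f 1 * f 2"
  unfolding UNIV_2 by simp

lemma prod_UNIV_3: "prod f (UNIV :: 3 set) = f 1 * f 2 * f 3"
  for f :: "3 \<Rightarrow> real"
  unfolding UNIV_3 by simp

text \<open>These three identifications of \<open>\<real> \<times> \<real>\<^sup>2\<close> with \<open>\<real>\<^sup>3\<close> make Fubini's theorem applicable with each of
  the coordinates as the inner variable of integration.\<close>

lemma distr_lborel_insert_coordinate:
  fixes J :: "real \<times> (real^2) \<Rightarrow> real^3"
  assumes J: "(J = (\<lambda>(t, y). vector [t, y$1, y$2])) \<or> (J = (\<lambda>(t, y). vector [y$1, t, y$2]))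
     \<or> (J = (\<lambda>(t, y). vector [y$1, y$2, t]))"
  shows "J \<in> borel_measurable borel" "distr lborel lborel J = lborel"
proof -
  have "continuous_on UNIV J"
    using J by (elim disjE) (auto simp: case_prod_unfold intro!: continuous_on_vector_3 continuous_intros)
  then show m: "J \<in> borel_measurable borel"
    by (rule borel_measurable_continuous_onI)
  show "distr lborel lborel J = lborel"
  proof (rule lborel_eqI[symmetric])
    fix l u :: "real^3"
    assume "\<And>b. b \<in> Basis \<Longrightarrow> l \<bullet> b \<le> u \<bullet> b"
    then have le: "l $ i \<le> u $ i" for i
      by (metis axis_in_Basis_iff cart_eq_inner_axis Basis_real_def insertI1)
    have B3: "(\<Prod>b\<in>Basis. (u - l) \<bullet> b) = (u$1 - l$1) * (u$2 - l$2) * (u$3 - l$3)"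
    proof -
      have "(\<Prod>b\<in>Basis. (u - l) \<bullet> b) = (\<Prod>i\<in>UNIV. (u - l) \<bullet> axis i 1)"
        unfolding Basis_vec_def
        by (subst prod.reindex_bij_betw[of "\<lambda>i. axis i 1" UNIV, symmetric]) (auto simp: bij_betw_def inj_on_def axis_eq_axis)
      then show ?thesis by (simp add: prod_UNIV_3 inner_axis)
    qed
    have vol: "emeasure lborel ({a<..<b} \<times> box p q) = (b - a) * (q$1 - p$1) * (q$2 - p$2)"
      if "a \<le> b" "p$1 \<le> q$1" "p$2 \<le> q$2" for a b :: real and p q :: "real^2"
    proof -
      have "emeasure lborel ({a<..<b} \<times> box p q) = emeasure lborel {a<..<b} * emeasure lborel (box p q)"
        unfolding lborel_prod[symmetric] by (rule lborel.emeasure_pair_measure_Times) auto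
      also have "emeasure lborel (box p q) = (\<Prod>b\<in>Basis. (q - p) \<bullet> b)"
      proof (rule emeasure_lborel_box)
        have "p $ i \<le> q $ i" for i using that exhaust_2[of i] by auto
        then show "p \<bullet> b \<le> q \<bullet> b" if "b \<in> Basis" for b
          using that by (auto simp: Basis_vec_def inner_axis)
      qed
      also have "(\<Prod>b\<in>Basis. (q - p) \<bullet> b) = (\<Prod>i\<in>UNIV. (q - p) \<bullet> axis i 1)"
        unfolding Basis_vec_def
        by (subst prod.reindex_bij_betw[of "\<lambda>i. axis i 1" UNIV, symmetric]) (auto simp: bij_betw_def inj_on_def axis_eq_axis)
      finally show ?thesis
        using that by (simp add: prod_UNIV_2 inner_axis ennreal_mult' mult.assoc)
    qed
    have "emeasure (distr lborel lborel J) (box l u) = emeasure lborel (J -` box l u)"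
      using m by (simp add: emeasure_distr)
    also have "\<dots> = (u$1 - l$1) * (u$2 - l$2) * (u$3 - l$3)"
    proof -
      have "J = (\<lambda>(t, y). vector [t, y$1, y$2]) \<Longrightarrow> J -` box l u = {l$1<..<u$1} \<times> box (vector [l$2, l$3]) (vector [u$2, u$3])"
        "J = (\<lambda>(t, y). vector [y$1, t, y$2]) \<Longrightarrow> J -` box l u = {l$2<..<u$2} \<times> box (vector [l$1, l$3]) (vector [u$1, u$3])"
        "J = (\<lambda>(t, y). vector [y$1, y$2, t]) \<Longrightarrow> J -` box l u = {l$3<..<u$3} \<times> box (vector [l$1, l$2]) (vector [u$1, u$2])"
        by (auto simp: mem_box_cart forall_2 forall_3)
      with J show ?thesis
        by (elim disjE) (simp_all add: vol le mult_ac)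
    qed
    finally show "emeasure (distr lborel lborel J) (box l u) = (\<Prod>b\<in>Basis. (u - l) \<bullet> b)"
      using B3 by simp
  qed simp
qed

text \<open>Integration along the segments of direction \<open>e\<close>: the fundamental theorem of calculus leaves the
  values at the end point on the slanted face and at the initial point on a coordinate face.\<close>

lemma integral_partial_derivative_simplex:
  fixes J :: "real \<times> (real^2) \<Rightarrow> real^3" and z :: "real^3 \<Rightarrow> real"
  assumes Jm: "J \<in> borel_measurable borel" "distr lborel lborel J = lborel"
    and JT: "\<And>t y. J (t, y) \<in> solid_simplex3 \<longleftrightarrow> 0 \<le> t \<and> t \<le> 1 - y$1 - y$2 \<and> y \<in> solid_simplex2"
    and Je: "\<And>t y. J (t, y) = J (0, y) + t *\<^sub>R e"
    and J0: "continuous_on UNIV (\<lambda>y. J (0, y))"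
    and z: "C1_on W z z'" and W: "solid_simplex3 \<subseteq> W"
  shows "integral solid_simplex3 (\<lambda>x. z' x e)
    = integral solid_simplex2 (\<lambda>y. z (J (1 - y$1 - y$2, y))) - integral solid_simplex2 (\<lambda>y. z (J (0, y)))"
proof -
  let ?F = "\<lambda>x. indicator solid_simplex3 x *\<^sub>R z' x e"
  let ?G = "\<lambda>y. z (J (1 - y$1 - y$2, y)) - z (J (0, y))"
  have F: "integrable lborel ?F"
    using C1_onD(3)[OF z] W by (intro borel_integrable_compact compact_solid_simplex3) (meson continuous_on_subset)
  have contJ: "continuous_on solid_simplex2 (\<lambda>y. z (J (f y, y)))"
    if f: "continuous_on UNIV f" "\<And>y. y \<in> solid_simplex2 \<Longrightarrow> 0 \<le> f y \<and> f y \<le> 1 - y$1 - y$2" for f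
  proof (rule continuous_on_compose2[OF C1_onD(4)[OF z]])
    have "continuous_on UNIV (\<lambda>y. J (0, y) + f y *\<^sub>R e)"
      using f J0 by (intro continuous_intros)
    then show "continuous_on solid_simplex2 (\<lambda>y. J (f y, y))"
      by (subst Je) (rule continuous_on_subset, auto)
    show "(\<lambda>y. J (f y, y)) ` solid_simplex2 \<subseteq> W"
      using W JT f by blast
  qed
  have c1: "continuous_on solid_simplex2 (\<lambda>y. z (J (1 - y$1 - y$2, y)))"
    by (rule contJ) (auto intro!: continuous_intros simp: mem_solid_simplex2)
  have c0: "continuous_on solid_simplex2 (\<lambda>y. z (J (0, y)))"
    by (rule contJ) (auto simp: mem_solid_simplex2)
  have "integral solid_simplex3 (\<lambda>x. z' x e) = (LINT x|lborel. ?F x)"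
    using F set_borel_integral_eq_integral(2)[of solid_simplex3 "\<lambda>x. z' x e"]
    by (simp add: set_integrable_def set_lebesgue_integral_def)
  also have "\<dots> = (LINT x|distr lborel lborel J. ?F x)" by (simp add: Jm)
  also have "\<dots> = (LINT p|lborel. ?F (J p))"
    using Jm(1) by (intro integral_distr borel_measurable_integrable[OF F]) simp
  also have "\<dots> = (LINT y|lborel. LINT t|lborel. ?F (J (t, y)))"
  proof -
    have "integrable (distr lborel lborel J) ?F" using F Jm by simp
    then have "integrable lborel (\<lambda>p. ?F (J p))"
      using Jm(1) borel_measurable_integrable[OF F] integrable_distr_eq[of J lborel lborel ?F] by simp
    then have "integrable (lborel \<Otimes>\<^sub>M lborel) (\<lambda>(t, y). ?F (J (t, y)))"
      by (simp add: lborel_prod case_prod_unfold)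
    from lborel_pair.integral_snd[OF this] show ?thesis
      by (simp add: lborel_prod case_prod_unfold)
  qed
  also have "\<dots> = (LINT y|lborel. indicator solid_simplex2 y *\<^sub>R ?G y)"
  proof (rule Bochner_Integration.integral_cong[OF refl])
    fix y :: "real^2"
    show "(LINT t|lborel. ?F (J (t, y))) = indicator solid_simplex2 y *\<^sub>R ?G y"
    proof (cases "y \<in> solid_simplex2")
      case False
      then have "(\<lambda>t. ?F (J (t, y))) = (\<lambda>t. 0)" by (auto simp: JT indicator_def)
      then show ?thesis using False by simp
    next
      case y: True
      let ?b = "1 - y$1 - y$2"
      have eq: "?F (J (t, y)) = z' (J (t, y)) e * indicator {0..?b} t" for t
        using y by (auto simp: JT indicator_def)
      have JW: "J (t, y) \<in> W" if "0 \<le> t" "t \<le> ?b" for t using that y JT W by auto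
      have cJ: "isCont (\<lambda>t. J (t, y)) t" for t by (subst Je) (intro continuous_intros)
      have "(LINT t|lborel. z' (J (t, y)) e * indicator {0..?b} t) = z (J (?b, y)) - z (J (0, y))"
      proof (rule integral_FTC_Icc_real)
        show "0 \<le> ?b" using y by (simp add: mem_solid_simplex2)
        show "((\<lambda>t. z (J (t, y))) has_real_derivative z' (J (t, y)) e) (at t)" if "0 \<le> t" "t \<le> ?b" for t
        proof -
          have "((\<lambda>t. J (t, y)) has_derivative (\<lambda>h. h *\<^sub>R e)) (at t)"
            by (subst Je) (auto intro!: derivative_eq_intros)
          from has_derivative_compose[OF this C1_onD(2)[OF z JW[OF that]]]
          show ?thesis
            by (rule has_derivative_imp_has_field_derivative)
              (simp add: linear_cmul[OF C1_onD(5)[OF z JW[OF that]]])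
        qed
        show "isCont (\<lambda>t. z' (J (t, y)) e) t" if "0 \<le> t" "t \<le> ?b" for t
        proof -
          have "isCont (\<lambda>x. z' x e) (J (t, y))"
            using C1_onD(1,3)[OF z] JW[OF that] continuous_on_eq_continuous_at by blast
          with cJ show ?thesis by (rule isCont_o2)
        qed
      qed
      then show ?thesis unfolding eq using y by simp
    qed
  qed
  also have "\<dots> = integral solid_simplex2 ?G"
    using set_borel_integral_eq_integral(2)[OF set_integrable_lborel_compact[OF compact_solid_simplex2, of ?G, OF continuous_on_diff[OF c1 c0]]]
    by (simp add: set_lebesgue_integral_def)
  also have "\<dots> = integral solid_simplex2 (\<lambda>y. z (J (1 - y$1 - y$2, y))) - integral solid_simplex2 (\<lambda>y. z (J (0, y)))"
    using c0 c1 by (intro integral_diff set_borel_integral_eq_integral(1) set_integrable_lborel_compact compact_solid_simplex2)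
  finally show ?thesis .
qed

lemma has_absolute_integral_change_of_variables_scalar:
  fixes f :: "real^'m::{finite,wellorder} \<Rightarrow> real" and g :: "real^'m::_ \<Rightarrow> real^'m::_"
  assumes S: "S \<in> sets lebesgue"
    and der_g: "\<And>x. x \<in> S \<Longrightarrow> (g has_derivative g' x) (at x within S)"
    and inj: "inj_on g S"
  shows "(\<lambda>x. \<bar>det (matrix (g' x))\<bar> * f(g x)) absolutely_integrable_on S \<and>
           integral S (\<lambda>x. \<bar>det (matrix (g' x))\<bar> * f(g x)) = b
     \<longleftrightarrow> f absolutely_integrable_on (g ` S) \<and> integral (g ` S) f = b"
  using has_absolute_integral_change_of_variables[OF assms, of "\<lambda>x. vec (f x) :: real^1" "vec b"]
  by (simp add: absolutely_integrable_on_1_iff integral_on_1_eq o_def)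

text \<open>The three directions of integration parametrize the slanted face differently. These
  area-preserving affine symmetries of the triangle reduce them to the parametrization used by the
  face operator of singular homology.\<close>

lemma integral_simplex2_symmetry:
  fixes f :: "real^2 \<Rightarrow> real"
  assumes f: "continuous_on solid_simplex2 f"
  shows "integral solid_simplex2 (\<lambda>y. f (vector [1 - y$1 - y$2, y$2])) = integral solid_simplex2 f"
    and "integral solid_simplex2 (\<lambda>y. f (vector [y$2, 1 - y$1 - y$2])) = integral solid_simplex2 f"
proof -
  have *: "integral solid_simplex2 (\<lambda>y. f (r y)) = integral solid_simplex2 f"
    if r: "\<And>x. (r has_derivative r') (at x)" and d: "\<bar>det (matrix r')\<bar> = 1"
      and q: "\<And>y. q (r y) = y" "\<And>y. r (q y) = y"
      and T: "\<And>y. y \<in> solid_simplex2 \<Longrightarrow> r y \<in> solid_simplex2" "\<And>y. y \<in> solid_simplex2 \<Longrightarrow> q y \<in> solid_simplex2"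
    for r r' q :: "real^2 \<Rightarrow> real^2"
  proof -
    have im: "r ` solid_simplex2 = solid_simplex2"
      using q T by (metis (no_types, lifting) image_eqI subsetI subset_antisym image_subset_iff)
    have "inj_on r solid_simplex2" using q by (metis inj_onI)
    moreover have "solid_simplex2 \<in> sets lebesgue"
      using compact_solid_simplex2 by (auto intro: lmeasurable_compact fmeasurableD)
    ultimately show ?thesis
      using has_absolute_integral_change_of_variables_scalar[of solid_simplex2 r "\<lambda>_. r'" f "integral solid_simplex2 f"]
        absolutely_integrable_on_compact[OF compact_solid_simplex2 f] r d
      by (auto simp: im intro: has_derivative_at_withinI)
  qed
  show "integral solid_simplex2 (\<lambda>y. f (vector [1 - y$1 - y$2, y$2])) = integral solid_simplex2 f"
  proof (rule *)
    show "((\<lambda>y::real^2. vector [1 - y$1 - y$2, y$2]) has_derivative (\<lambda>y. vector [- y$1 - y$2, y$2] :: real^2)) (at x)" for x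
      unfolding vector_2_axis
      by (auto intro!: derivative_eq_intros bounded_linear_imp_has_derivative[OF bounded_linear_vec_nth])
    show "vector [1 - (vector [1 - y$1 - y$2, y$2] :: real^2)$1 - (vector [1 - y$1 - y$2, y$2] :: real^2)$2,
        (vector [1 - y$1 - y$2, y$2] :: real^2)$2] = y" for y :: "real^2"
      by (simp add: vec_eq_iff forall_2)
    then show "vector [1 - (vector [1 - y$1 - y$2, y$2] :: real^2)$1 - (vector [1 - y$1 - y$2, y$2] :: real^2)$2,
        (vector [1 - y$1 - y$2, y$2] :: real^2)$2] = y" for y :: "real^2" .
  qed (simp_all add: mem_solid_simplex2 det_2 matrix_def axis_def)
  show "integral solid_simplex2 (\<lambda>y. f (vector [y$2, 1 - y$1 - y$2])) = integral solid_simplex2 f"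
  proof (rule *)
    show "((\<lambda>y::real^2. vector [y$2, 1 - y$1 - y$2]) has_derivative (\<lambda>y. vector [y$2, - y$1 - y$2] :: real^2)) (at x)" for x
      unfolding vector_2_axis
      by (auto intro!: derivative_eq_intros bounded_linear_imp_has_derivative[OF bounded_linear_vec_nth])
    show "vector [1 - (vector [y$2, 1 - y$1 - y$2] :: real^2)$1 - (vector [y$2, 1 - y$1 - y$2] :: real^2)$2,
        (vector [y$2, 1 - y$1 - y$2] :: real^2)$1] = y" for y :: "real^2"
      by (simp add: vec_eq_iff forall_2)
    show "vector [(vector [1 - y$1 - y$2, y$1] :: real^2)$2,
        1 - (vector [1 - y$1 - y$2, y$1] :: real^2)$1 - (vector [1 - y$1 - y$2, y$1] :: real^2)$2] = y" for y :: "real^2"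
      by (simp add: vec_eq_iff forall_2)
  qed (simp_all add: mem_solid_simplex2 det_2 matrix_def axis_def)
qed

lemma divergence_theorem_simplex:
  fixes Z :: "3 \<Rightarrow> real^3 \<Rightarrow> real"
  assumes Z: "\<And>i. C1_on W (Z i) (Z' i)" and W: "solid_simplex3 \<subseteq> W"
  shows "integral solid_simplex3 (\<lambda>x. \<Sum>i\<in>UNIV. Z' i x (axis i 1))
    = integral solid_simplex2 (\<lambda>y. \<Sum>i\<in>UNIV. Z i (vector [1 - y$1 - y$2, y$1, y$2]))
      - integral solid_simplex2 (\<lambda>y. Z 1 (vector [0, y$1, y$2]))
      - integral solid_simplex2 (\<lambda>y. Z 2 (vector [y$1, 0, y$2]))
      - integral solid_simplex2 (\<lambda>y. Z 3 (vector [y$1, y$2, 0]))"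
proof -
  let ?f = "\<lambda>i y. Z i (vector [1 - y$1 - y$2, y$1, y$2])"
  have f: "continuous_on solid_simplex2 (?f i)" for i
  proof (rule continuous_on_compose2[OF C1_onD(4)[OF Z[of i]]])
    show "continuous_on solid_simplex2 (\<lambda>y. vector [1 - y$1 - y$2, y$1, y$2] :: real^3)"
      by (intro continuous_on_vector_3 continuous_intros)
    show "(\<lambda>y. vector [1 - y$1 - y$2, y$1, y$2]) ` solid_simplex2 \<subseteq> W"
      using W by (auto simp: mem_solid_simplex2 mem_solid_simplex3 subset_iff)
  qed
  let ?J1 = "\<lambda>(t::real, y::real^2). vector [t, y$1, y$2] :: real^3"
  let ?J2 = "\<lambda>(t::real, y::real^2). vector [y$1, t, y$2] :: real^3"
  let ?J3 = "\<lambda>(t::real, y::real^2). vector [y$1, y$2, t] :: real^3"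
  have 1: "integral solid_simplex3 (\<lambda>x. Z' 1 x (axis 1 1)) = integral solid_simplex2 (\<lambda>y. Z 1 (?J1 (1 - y$1 - y$2, y)))
      - integral solid_simplex2 (\<lambda>y. Z 1 (?J1 (0, y)))"
    by (rule integral_partial_derivative_simplex[OF distr_lborel_insert_coordinate(1) distr_lborel_insert_coordinate(2) _ _ _ Z W])
      (auto simp: mem_solid_simplex2 mem_solid_simplex3 vec_eq_iff forall_3 axis_def intro!: continuous_on_vector_3 continuous_intros)
  have 2: "integral solid_simplex3 (\<lambda>x. Z' 2 x (axis 2 1)) = integral solid_simplex2 (\<lambda>y. Z 2 (?J2 (1 - y$1 - y$2, y)))
      - integral solid_simplex2 (\<lambda>y. Z 2 (?J2 (0, y)))"
    by (rule integral_partial_derivative_simplex[OF distr_lborel_insert_coordinate(1) distr_lborel_insert_coordinate(2) _ _ _ Z W])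
      (auto simp: mem_solid_simplex2 mem_solid_simplex3 vec_eq_iff forall_3 axis_def intro!: continuous_on_vector_3 continuous_intros)
  have 3: "integral solid_simplex3 (\<lambda>x. Z' 3 x (axis 3 1)) = integral solid_simplex2 (\<lambda>y. Z 3 (?J3 (1 - y$1 - y$2, y)))
      - integral solid_simplex2 (\<lambda>y. Z 3 (?J3 (0, y)))"
    by (rule integral_partial_derivative_simplex[OF distr_lborel_insert_coordinate(1) distr_lborel_insert_coordinate(2) _ _ _ Z W])
      (auto simp: mem_solid_simplex2 mem_solid_simplex3 vec_eq_iff forall_3 axis_def intro!: continuous_on_vector_3 continuous_intros)
  have "integral solid_simplex3 (\<lambda>x. Z' 1 x (axis 1 1)) = integral solid_simplex2 (?f 1)
      - integral solid_simplex2 (\<lambda>y. Z 1 (vector [0, y$1, y$2]))"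
    using 1 by simp
  moreover have "integral solid_simplex3 (\<lambda>x. Z' 2 x (axis 2 1)) = integral solid_simplex2 (?f 2)
      - integral solid_simplex2 (\<lambda>y. Z 2 (vector [y$1, 0, y$2]))"
    using 2 integral_simplex2_symmetry(1)[OF f[of 2]] by simp
  moreover have "integral solid_simplex3 (\<lambda>x. Z' 3 x (axis 3 1)) = integral solid_simplex2 (?f 3)
      - integral solid_simplex2 (\<lambda>y. Z 3 (vector [y$1, y$2, 0]))"
    using 3 integral_simplex2_symmetry(2)[OF f[of 3]] by simp
  moreover have "integral solid_simplex2 (\<lambda>y. \<Sum>i\<in>UNIV. ?f i y) = (\<Sum>i\<in>UNIV. integral solid_simplex2 (?f i))"
    using f by (intro integral_sum set_borel_integral_eq_integral(1) set_integrable_lborel_compact compact_solid_simplex2) auto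
  moreover have "integral solid_simplex3 (\<lambda>x. \<Sum>i\<in>UNIV. Z' i x (axis i 1)) = (\<Sum>i\<in>UNIV. integral solid_simplex3 (\<lambda>x. Z' i x (axis i 1)))"
    using continuous_on_subset[OF C1_onD(3)[OF Z] W]
    by (intro integral_sum set_borel_integral_eq_integral(1) set_integrable_lborel_compact compact_solid_simplex3) auto
  ultimately show ?thesis by (simp add: sum_3)
qed

section \<open>Stokes' theorem for smooth singular chains\<close>

lemma smooth_on_imp_C1_extension:
  fixes f :: "'a::euclidean_space \<Rightarrow> 'b::euclidean_space"
  assumes "smooth_on K f"
  shows "\<exists>W g g' g''. K \<subseteq> W \<and> C1_on W g g' \<and> (\<forall>h. C1_on W (\<lambda>x. g' x h) (\<lambda>x. g'' x h)) \<and> (\<forall>x\<in>K. g x = f x)"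
proof -
  obtain W g where W: "open W" "K \<subseteq> W" "\<And>k. C_k_on k W g" "\<forall>x\<in>K. g x = f x"
    using assms unfolding smooth_on_def by blast
  then show ?thesis
    using C_k_on_Suc_imp_C1_on[OF W(1) W(3)] C_k_on_2_imp_C1_on_derivative[OF W(1) W(3)] by metis
qed

lemma has_derivative_interior:
  assumes "C1_on W g g'" "K \<subseteq> W" "\<forall>x\<in>K. g x = f x" "y \<in> interior K"
  shows "(f has_derivative g' y) (at y)"
proof (rule has_derivative_transform_within_open)
  show "(g has_derivative g' y) (at y)"
    using assms interior_subset by (blast intro: C1_onD(2))
qed (use assms interior_subset in \<open>auto simp: subset_iff\<close>)

lemma partial_deriv_eqI: "(g has_derivative g') (at y) \<Longrightarrow> partial_deriv i g y = g' (axis i 1)"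
  unfolding partial_deriv_def by (metis frechet_derivative_at)

definition flux :: "(real^3 \<Rightarrow> real^3) \<Rightarrow> ((nat \<Rightarrow> real) \<Rightarrow> real^3) \<Rightarrow> real" where
  "flux Y \<sigma> = integral (interior solid_simplex2) (\<lambda>y. Y (\<sigma> (bary2 y)) \<bullet>
     cross3 (partial_deriv 1 (\<sigma> \<circ> bary2) y) (partial_deriv 2 (\<sigma> \<circ> bary2) y))"

text \<open>Here \<open>a\<close> is the affine face inclusion in the coordinates of the solid simplices.\<close>

lemma flux_singular_face:
  fixes g :: "real^3 \<Rightarrow> real^3"
  assumes g: "C1_on W g g'" "solid_simplex3 \<subseteq> W" "\<forall>x\<in>solid_simplex3. g x = \<sigma> (bary3 x)"
    and a: "\<And>y. (a has_derivative a') (at y)" "\<And>y. y \<in> solid_simplex2 \<Longrightarrow> a y \<in> solid_simplex3"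
    and face: "\<And>y. bary3 (a y) = simplical_face k (bary2 y)"
  shows "flux Y (singular_face 3 k \<sigma>)
    = integral solid_simplex2 (\<lambda>y. Y (g (a y)) \<bullet> cross3 (g' (a y) (a' (axis 1 1))) (g' (a y) (a' (axis 2 1))))"
proof -
  let ?s = "singular_face 3 k \<sigma>"
  have eq: "?s (bary2 y) = g (a y)" if "y \<in> solid_simplex2" for y
  proof -
    have "bary2 y \<in> standard_simplex 2" using that by (simp add: solid_simplex2_def)
    then have "?s (bary2 y) = \<sigma> (bary3 (a y))"
      by (simp add: singular_face_def face numeral_3_eq_3 numeral_2_eq_2)
    then show ?thesis using g(3) a(2)[OF that] by simp
  qed
  have pd: "partial_deriv i (?s \<circ> bary2) y = g' (a y) (a' (axis i 1))" if y: "y \<in> interior solid_simplex2" for i y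
  proof (rule partial_deriv_eqI[of _ "\<lambda>h. g' (a y) (a' h)", simplified], rule has_derivative_transform_within_open)
    have "a y \<in> W" using y interior_subset a(2) g(2) by blast
    then show "((\<lambda>y. g (a y)) has_derivative (\<lambda>h. g' (a y) (a' h))) (at y)"
      using has_derivative_compose[OF a(1) C1_onD(2)[OF g(1)]] by blast
    show "g (a x) = (?s \<circ> bary2) x" if "x \<in> interior solid_simplex2" for x
      using that eq interior_subset by fastforce
  qed (use y in auto)
  have "flux Y ?s = integral (interior solid_simplex2)
      (\<lambda>y. Y (g (a y)) \<bullet> cross3 (g' (a y) (a' (axis 1 1))) (g' (a y) (a' (axis 2 1))))"
    unfolding flux_def
  proof (rule integral_cong)
    fix y assume y: "y \<in> interior solid_simplex2"
    then have "y \<in> solid_simplex2" using interior_subset by blast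
    with y show "Y (?s (bary2 y)) \<bullet> cross3 (partial_deriv 1 (?s \<circ> bary2) y) (partial_deriv 2 (?s \<circ> bary2) y)
      = Y (g (a y)) \<bullet> cross3 (g' (a y) (a' (axis 1 1))) (g' (a y) (a' (axis 2 1)))"
      by (simp only: eq pd)
  qed
  then show ?thesis
    by (simp add: integral_interior_convex convex_solid_simplex2)
qed

lemma bary3_face:
  shows "bary3 (vector [1 - y$1 - y$2, y$1, y$2]) = simplical_face 0 (bary2 y)"
    and "bary3 (vector [0, y$1, y$2]) = simplical_face 1 (bary2 y)"
    and "bary3 (vector [y$1, 0, y$2]) = simplical_face 2 (bary2 y)"
    and "bary3 (vector [y$1, y$2, 0]) = simplical_face 3 (bary2 y)"
proof -
  have *: "f = h" if "f 0 = h 0" "f 1 = h 1" "f 2 = h 2" "f 3 = h 3" "\<And>i. f (i + 4) = h (i + 4)"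
    for f h :: "nat \<Rightarrow> real"
  proof
    fix i :: nat
    consider "i = 0" | "i = 1" | "i = 2" | "i = 3" | "i = (i - 4) + 4" by linarith
    then show "f i = h i" by cases (use that in metis)+
  qed
  show "bary3 (vector [1 - y$1 - y$2, y$1, y$2]) = simplical_face 0 (bary2 y)"
    by (rule *) (simp_all add: bary3_def bary2_def simplical_face_def)
  show "bary3 (vector [0, y$1, y$2]) = simplical_face 1 (bary2 y)"
    by (rule *) (simp_all add: bary3_def bary2_def simplical_face_def)
  show "bary3 (vector [y$1, 0, y$2]) = simplical_face 2 (bary2 y)"
    by (rule *) (simp_all add: bary3_def bary2_def simplical_face_def)
  show "bary3 (vector [y$1, y$2, 0]) = simplical_face 3 (bary2 y)"
    by (rule *) (simp_all add: bary3_def bary2_def simplical_face_def)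
qed

text \<open>The signs of the face operators agree with those of the divergence theorem: among the
  coordinate faces, only the one opposite to vertex 2 carries its two tangent vectors in anticyclic
  order. On the slanted face, opposite to vertex 0, the cross product of the
  differences \<open>g\<^sub>2 - g\<^sub>1\<close> and \<open>g\<^sub>3 - g\<^sub>1\<close> expands into the sum of all three components of the
  pull-back.\<close>

lemma stokes_singular_simplex:
  assumes s: "smooth_on solid_simplex3 (\<sigma> \<circ> bary3)" and Y: "C1_on V Y Y'"
    and sV: "\<sigma> ` standard_simplex 3 \<subseteq> V"
  shows "(\<Sum>k\<le>3. (-1) ^ k * flux Y (singular_face 3 k \<sigma>)) =
    integral (interior solid_simplex3) (\<lambda>y. divergence Y' (\<sigma> (bary3 y)) *
      det (matrix (frechet_derivative (\<sigma> \<circ> bary3) (at y))))"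
proof -
  obtain W0 g g' g'' where g0: "solid_simplex3 \<subseteq> W0" "C1_on W0 g g'"
    "\<And>h. C1_on W0 (\<lambda>x. g' x h) (\<lambda>x. g'' x h)" and gs: "\<forall>x\<in>solid_simplex3. g x = \<sigma> (bary3 x)"
    using smooth_on_imp_C1_extension[OF s] by (metis comp_apply)
  \<comment> \<open>shrink the domain of the extension, so that it stays where the field \<open>Y\<close> is defined\<close>
  define W where "W = W0 \<inter> g -` V"
  have oW: "open W"
    unfolding W_def by (rule continuous_open_preimage[OF C1_onD(4)[OF g0(2)] C1_onD(1)[OF g0(2)] C1_onD(1)[OF Y]])
  have g: "C1_on W g g'" "\<And>h. C1_on W (\<lambda>x. g' x h) (\<lambda>x. g'' x h)"
    using C1_on_subset[OF g0(2) oW] C1_on_subset[OF g0(3) oW] by (auto simp: W_def)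
  have gV: "g ` W \<subseteq> V" by (auto simp: W_def)
  have TW: "solid_simplex3 \<subseteq> W"
    using g0(1) gs sV by (auto simp: W_def solid_simplex3_def)
  let ?Z = "pullback_field Y g g'"
  obtain Z' where Z: "\<And>i. C1_on W (?Z i) (Z' i)"
    "\<And>x. x \<in> W \<Longrightarrow> (\<Sum>i\<in>UNIV. Z' i x (axis i 1)) = divergence Y' (g x) * det (matrix (g' x))"
    using piola_identity[OF g Y gV] by blast
  note lin = C1_onD(5)[OF g(1)]
  note der = derivative_eq_intros bounded_linear_imp_has_derivative[OF bounded_linear_vec_nth]
  note T = mem_solid_simplex2 mem_solid_simplex3
  have ar: "(2::3) + 2 = 1" "(3::3) + 1 = 1" "(3::3) + 2 = 2" "(1::3) + 2 = 3" "(2::3) + 1 = 3" "(1::3) + 1 = 2"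
    by auto
  have face:
    "flux Y (singular_face 3 0 \<sigma>) = integral solid_simplex2 (\<lambda>y. Y (g (vector [1 - y$1 - y$2, y$1, y$2])) \<bullet>
       cross3 (g' (vector [1 - y$1 - y$2, y$1, y$2]) (axis 2 1 - axis 1 1)) (g' (vector [1 - y$1 - y$2, y$1, y$2]) (axis 3 1 - axis 1 1)))"
    "flux Y (singular_face 3 1 \<sigma>) = integral solid_simplex2 (\<lambda>y. Y (g (vector [0, y$1, y$2])) \<bullet>
       cross3 (g' (vector [0, y$1, y$2]) (axis 2 1)) (g' (vector [0, y$1, y$2]) (axis 3 1)))"
    "flux Y (singular_face 3 2 \<sigma>) = integral solid_simplex2 (\<lambda>y. Y (g (vector [y$1, 0, y$2])) \<bullet>
       cross3 (g' (vector [y$1, 0, y$2]) (axis 1 1)) (g' (vector [y$1, 0, y$2]) (axis 3 1)))"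
    "flux Y (singular_face 3 3 \<sigma>) = integral solid_simplex2 (\<lambda>y. Y (g (vector [y$1, y$2, 0])) \<bullet>
       cross3 (g' (vector [y$1, y$2, 0]) (axis 1 1)) (g' (vector [y$1, y$2, 0]) (axis 2 1)))"
  proof -
    show "flux Y (singular_face 3 0 \<sigma>) = integral solid_simplex2 (\<lambda>y. Y (g (vector [1 - y$1 - y$2, y$1, y$2])) \<bullet>
       cross3 (g' (vector [1 - y$1 - y$2, y$1, y$2]) (axis 2 1 - axis 1 1)) (g' (vector [1 - y$1 - y$2, y$1, y$2]) (axis 3 1 - axis 1 1)))"
    proof -
      have "((\<lambda>y::real^2. vector [1 - y$1 - y$2, y$1, y$2] :: real^3) has_derivative (\<lambda>y. vector [- y$1 - y$2, y$1, y$2])) (at y)" for y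
        unfolding vector_3_axis by (auto intro!: der)
      moreover have "vector [1 - y$1 - y$2, y$1, y$2] \<in> solid_simplex3" if "y \<in> solid_simplex2" for y :: "real^2"
        using that by (simp add: T)
      moreover have e: "(vector [- (axis 1 1 :: real^2)$1 - (axis 1 1 :: real^2)$2, (axis 1 1 :: real^2)$1, (axis 1 1 :: real^2)$2] :: real^3) = axis 2 1 - axis 1 1"
        "(vector [- (axis 2 1 :: real^2)$1 - (axis 2 1 :: real^2)$2, (axis 2 1 :: real^2)$1, (axis 2 1 :: real^2)$2] :: real^3) = axis 3 1 - axis 1 1"
        by (simp_all add: vec_eq_iff forall_3 axis_def)
      ultimately show ?thesis
        by - (drule flux_singular_face[OF g(1) TW gs _ _ bary3_face(1), where Y = Y], assumption, simp only: e)
    qed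
    show "flux Y (singular_face 3 1 \<sigma>) = integral solid_simplex2 (\<lambda>y. Y (g (vector [0, y$1, y$2])) \<bullet>
       cross3 (g' (vector [0, y$1, y$2]) (axis 2 1)) (g' (vector [0, y$1, y$2]) (axis 3 1)))"
    proof -
      have "((\<lambda>y::real^2. vector [0, y$1, y$2] :: real^3) has_derivative (\<lambda>y. vector [0, y$1, y$2])) (at y)" for y
        unfolding vector_3_axis by (auto intro!: der)
      moreover have "vector [0, y$1, y$2] \<in> solid_simplex3" if "y \<in> solid_simplex2" for y :: "real^2"
        using that by (simp add: T)
      moreover have e: "(vector [0, (axis 1 1 :: real^2)$1, (axis 1 1 :: real^2)$2] :: real^3) = axis 2 1"
        "(vector [0, (axis 2 1 :: real^2)$1, (axis 2 1 :: real^2)$2] :: real^3) = axis 3 1"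
        by (simp_all add: vec_eq_iff forall_3 axis_def)
      ultimately show ?thesis
        by - (drule flux_singular_face[OF g(1) TW gs _ _ bary3_face(2), where Y = Y], assumption, simp only: e)
    qed
    show "flux Y (singular_face 3 2 \<sigma>) = integral solid_simplex2 (\<lambda>y. Y (g (vector [y$1, 0, y$2])) \<bullet>
       cross3 (g' (vector [y$1, 0, y$2]) (axis 1 1)) (g' (vector [y$1, 0, y$2]) (axis 3 1)))"
    proof -
      have "((\<lambda>y::real^2. vector [y$1, 0, y$2] :: real^3) has_derivative (\<lambda>y. vector [y$1, 0, y$2])) (at y)" for y
        unfolding vector_3_axis by (auto intro!: der)
      moreover have "vector [y$1, 0, y$2] \<in> solid_simplex3" if "y \<in> solid_simplex2" for y :: "real^2"
        using that by (simp add: T)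
      moreover have e: "(vector [(axis 1 1 :: real^2)$1, 0, (axis 1 1 :: real^2)$2] :: real^3) = axis 1 1"
        "(vector [(axis 2 1 :: real^2)$1, 0, (axis 2 1 :: real^2)$2] :: real^3) = axis 3 1"
        by (simp_all add: vec_eq_iff forall_3 axis_def)
      ultimately show ?thesis
        by - (drule flux_singular_face[OF g(1) TW gs _ _ bary3_face(3), where Y = Y], assumption, simp only: e)
    qed
    show "flux Y (singular_face 3 3 \<sigma>) = integral solid_simplex2 (\<lambda>y. Y (g (vector [y$1, y$2, 0])) \<bullet>
       cross3 (g' (vector [y$1, y$2, 0]) (axis 1 1)) (g' (vector [y$1, y$2, 0]) (axis 2 1)))"
    proof -
      have "((\<lambda>y::real^2. vector [y$1, y$2, 0] :: real^3) has_derivative (\<lambda>y. vector [y$1, y$2, 0])) (at y)" for y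
        unfolding vector_3_axis by (auto intro!: der)
      moreover have "vector [y$1, y$2, 0] \<in> solid_simplex3" if "y \<in> solid_simplex2" for y :: "real^2"
        using that by (simp add: T)
      moreover have e: "(vector [(axis 1 1 :: real^2)$1, (axis 1 1 :: real^2)$2, 0] :: real^3) = axis 1 1"
        "(vector [(axis 2 1 :: real^2)$1, (axis 2 1 :: real^2)$2, 0] :: real^3) = axis 2 1"
        by (simp_all add: vec_eq_iff forall_3 axis_def)
      ultimately show ?thesis
        by - (drule flux_singular_face[OF g(1) TW gs _ _ bary3_face(4), where Y = Y], assumption, simp only: e)
    qed
  qed
  have "flux Y (singular_face 3 0 \<sigma>) = integral solid_simplex2 (\<lambda>y. \<Sum>i\<in>UNIV. ?Z i (vector [1 - y$1 - y$2, y$1, y$2]))"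
  proof -
    have lin': "g' x (a - b) = g' x a - g' x b" if "x \<in> W" for x a b
      using lin[OF that] by (rule linear_diff)
    show ?thesis
      unfolding face(1)
    proof (rule integral_cong)
      fix y :: "real^2" assume "y \<in> solid_simplex2"
      then have "vector [1 - y$1 - y$2, y$1, y$2] \<in> W" using TW by (auto simp: T subset_iff)
      then show "Y (g (vector [1 - y$1 - y$2, y$1, y$2])) \<bullet> cross3
          (g' (vector [1 - y$1 - y$2, y$1, y$2]) (axis 2 1 - axis 1 1)) (g' (vector [1 - y$1 - y$2, y$1, y$2]) (axis 3 1 - axis 1 1))
        = (\<Sum>i\<in>UNIV. ?Z i (vector [1 - y$1 - y$2, y$1, y$2]))"
        by (simp only: lin' pullback_field_def sum_3 ar) (simp add: cross3_simps)
    qed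
  qed
  moreover have "flux Y (singular_face 3 1 \<sigma>) = integral solid_simplex2 (\<lambda>y. ?Z 1 (vector [0, y$1, y$2]))"
    unfolding pullback_field_def ar by (rule face(2))
  moreover have "- flux Y (singular_face 3 2 \<sigma>) = integral solid_simplex2 (\<lambda>y. ?Z 2 (vector [y$1, 0, y$2]))"
    unfolding pullback_field_def ar face(3) integral_neg[symmetric]
    by (subst cross_skew) (simp only: inner_minus_right)
  moreover have "flux Y (singular_face 3 3 \<sigma>) = integral solid_simplex2 (\<lambda>y. ?Z 3 (vector [y$1, y$2, 0]))"
    unfolding pullback_field_def ar by (rule face(4))
  moreover have "integral (interior solid_simplex3) (\<lambda>y. divergence Y' (\<sigma> (bary3 y)) *
      det (matrix (frechet_derivative (\<sigma> \<circ> bary3) (at y)))) = integral solid_simplex3 (\<lambda>x. \<Sum>i\<in>UNIV. Z' i x (axis i 1))"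
  proof (subst integral_interior_convex[OF convex_solid_simplex3, symmetric], rule integral_cong)
    fix y assume y: "y \<in> interior solid_simplex3"
    have "((\<sigma> \<circ> bary3) has_derivative g' y) (at y)"
      by (rule has_derivative_interior[OF g(1) TW _ y]) (use gs in auto)
    then have "frechet_derivative (\<sigma> \<circ> bary3) (at y) = g' y"
      by (metis frechet_derivative_at)
    moreover have "y \<in> solid_simplex3" using y interior_subset by blast
    moreover from this have "y \<in> W" using TW by blast
    ultimately show "divergence Y' (\<sigma> (bary3 y)) * det (matrix (frechet_derivative (\<sigma> \<circ> bary3) (at y)))
      = (\<Sum>i\<in>UNIV. Z' i y (axis i 1))"
      using gs by (simp add: Z(2))
  qed
  ultimately show ?thesis
    using divergence_theorem_simplex[OF Z(1) TW] by (simp add: numeral_3_eq_3 numeral_2_eq_2)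
qed

text \<open>The homomorphism from chains to the reals that extends a function on simplices. Formulating flux
  and volume in this way lets the cancellation of common faces happen in the group of chains.\<close>

definition chain_sum :: "('a \<Rightarrow> real) \<Rightarrow> ('a \<Rightarrow>\<^sub>0 int) \<Rightarrow> real" where
  "chain_sum I c = (\<Sum>\<sigma>\<in>Poly_Mapping.keys c. of_int (Poly_Mapping.lookup c \<sigma>) * I \<sigma>)"

lemma chain_sum_superset:
  assumes "finite A" "Poly_Mapping.keys c \<subseteq> A"
  shows "chain_sum I c = (\<Sum>\<sigma>\<in>A. of_int (Poly_Mapping.lookup c \<sigma>) * I \<sigma>)"
  unfolding chain_sum_def using assms by (intro sum.mono_neutral_left) (auto simp: in_keys_iff)

lemma chain_sum_add: "chain_sum I (a + b) = chain_sum I a + chain_sum I b"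
proof -
  let ?A = "Poly_Mapping.keys a \<union> Poly_Mapping.keys b"
  show ?thesis
    using keys_add[of a b]
    by (simp add: chain_sum_superset[of ?A] lookup_add algebra_simps sum.distrib)
qed

lemma chain_sum_cmul: "chain_sum I (frag_cmul k a) = of_int k * chain_sum I a"
  using keys_cmul[of k a]
  by (simp add: chain_sum_superset[of "Poly_Mapping.keys a"] sum_distrib_left mult.assoc)

lemma chain_sum_0 [simp]: "chain_sum I 0 = 0"
  by (simp add: chain_sum_def)

lemma chain_sum_diff: "chain_sum I (a - b) = chain_sum I a - chain_sum I b"
  using chain_sum_add[of I "a - b" b] by simp

lemma chain_sum_of [simp]: "chain_sum I (frag_of \<sigma>) = I \<sigma>"
  by (simp add: chain_sum_def)

lemma chain_sum_sum: "finite A \<Longrightarrow> chain_sum I (\<Sum>i\<in>A. f i) = (\<Sum>i\<in>A. chain_sum I (f i))"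
  by (induction A rule: finite_induct) (auto simp: chain_sum_add)

lemma chain_sum_frag_extend: "chain_sum I (frag_extend f c) = chain_sum (\<lambda>\<sigma>. chain_sum I (f \<sigma>)) c"
  unfolding frag_extend_def
  by (simp add: chain_sum_sum chain_sum_cmul) (simp add: chain_sum_def)

theorem stokes_smooth_chain:
  assumes c: "smooth_3_chain X c" and Y: "C1_on V Y Y'" and X: "X \<subseteq> V"
  shows "chain_sum (flux Y) (chain_boundary 3 c) =
    chain_sum (\<lambda>\<sigma>. integral (interior solid_simplex3) (\<lambda>y. divergence Y' (\<sigma> (bary3 y)) *
      det (matrix (frechet_derivative (\<sigma> \<circ> bary3) (at y))))) c"
proof -
  have "chain_sum (flux Y) (chain_boundary 3 c)
     = chain_sum (\<lambda>\<sigma>. \<Sum>k\<le>3. (-1) ^ k * flux Y (singular_face 3 k \<sigma>)) c"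
    by (simp add: chain_boundary_def chain_sum_frag_extend chain_sum_sum chain_sum_cmul)
  also have "\<dots> = chain_sum (\<lambda>\<sigma>. integral (interior solid_simplex3) (\<lambda>y. divergence Y' (\<sigma> (bary3 y)) *
      det (matrix (frechet_derivative (\<sigma> \<circ> bary3) (at y))))) c"
    unfolding chain_sum_def
  proof (intro sum.cong refl arg_cong2[where f = "(*)"])
    fix \<sigma> assume s: "\<sigma> \<in> Poly_Mapping.keys c"
    then have "singular_simplex 3 (top_of_set X) \<sigma>"
      using c by (auto simp: smooth_3_chain_def singular_chain_def)
    then have "\<sigma> ` standard_simplex 3 \<subseteq> X"
      by (auto simp: singular_simplex_def continuous_map_def topspace_standard_simplex Pi_iff)
    with s c X show "(\<Sum>k\<le>3. (-1) ^ k * flux Y (singular_face 3 k \<sigma>)) =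
      integral (interior solid_simplex3) (\<lambda>y. divergence Y' (\<sigma> (bary3 y)) *
        det (matrix (frechet_derivative (\<sigma> \<circ> bary3) (at y))))"
      by (intro stokes_singular_simplex[OF _ Y]) (auto simp: smooth_3_chain_def)
  qed
  finally show ?thesis .
qed

section \<open>The area of a surface that projects injectively to a plane\<close>

lemma has_integral_disjoint_UN:
  fixes f :: "'a::euclidean_space \<Rightarrow> real"
  assumes "finite I" "\<And>i. i \<in> I \<Longrightarrow> (f has_integral b i) (A i)"
    and "pairwise (\<lambda>i j. disjnt (A i) (A j)) I"
  shows "(f has_integral (\<Sum>i\<in>I. b i)) (\<Union>i\<in>I. A i)"
  using assms
proof (induction I rule: finite_induct)
  case (insert i I)
  then have "A i \<inter> (\<Union>j\<in>I. A j) = {}"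
    by (auto simp: pairwise_insert disjnt_def)
  then have "negligible (A i \<inter> (\<Union>j\<in>I. A j))" by simp
  with insert show ?case
    by (auto simp: pairwise_insert intro!: has_integral_Un)
qed auto

text \<open>The reparametrization by \<open>r\<close> produces a curve on the unit interval, as the tangent space
  requires; the span absorbs the factor.\<close>

lemma velocity_in_tangent_space:
  fixes f :: "'a::real_normed_vector \<Rightarrow> real^3"
  assumes f: "(f has_derivative f') (at a)" and r: "r > 0"
    and S: "\<And>t. 0 \<le> t \<Longrightarrow> t \<le> r \<Longrightarrow> f (a + t *\<^sub>R k) \<in> S"
  shows "f' k \<in> tangent_space S (f a)"
proof -
  let ?g = "\<lambda>t. f (a + (r * t) *\<^sub>R k)"
  have "((\<lambda>t. a + (r * t) *\<^sub>R k) has_derivative (\<lambda>h. (r * h) *\<^sub>R k)) (at 0)"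
    by (auto intro!: derivative_eq_intros)
  then have "(?g has_derivative (\<lambda>h. f' ((r * h) *\<^sub>R k))) (at 0)"
    by (rule has_derivative_compose) (use f in simp)
  moreover have "f' ((r * h) *\<^sub>R k) = h *\<^sub>R (r *\<^sub>R f' k)" for h
    using has_derivative_linear[OF f] by (simp add: linear_cmul)
  ultimately have "(?g has_vector_derivative r *\<^sub>R f' k) (at 0 within {0..1})"
    unfolding has_vector_derivative_def by (simp add: has_derivative_at_withinI)
  moreover have "?g ` {0..1} \<subseteq> S"
    using S r by (auto intro!: S simp: mult_left_le)
  ultimately have "r *\<^sub>R f' k \<in> tangent_space S (f a)"
    unfolding tangent_space_def by (intro span_base CollectI exI[of _ ?g]) auto
  then have "(1 / r) *\<^sub>R (r *\<^sub>R f' k) \<in> tangent_space S (f a)"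
    unfolding tangent_space_def by (rule span_mul)
  then show ?thesis using r by simp
qed

text \<open>The triple product expansion gives \<open>n \<times> (a \<times> b) = 0\<close>.\<close>

lemma cross_parallel_normal:
  fixes n :: "real^3"
  assumes n: "norm n = 1" and ab: "n \<bullet> a = 0" "n \<bullet> b = 0"
  shows "cross3 a b = (n \<bullet> cross3 a b) *\<^sub>R n"
proof -
  let ?c = "cross3 a b"
  have "cross3 n ?c = (n \<bullet> b) *\<^sub>R a - (n \<bullet> a) *\<^sub>R b"
    by (simp add: Lagrange)
  then have "(n \<bullet> ?c)\<^sup>2 = (norm ?c)\<^sup>2"
    using norm_cross_dot[of n ?c] n ab by simp
  moreover have "(norm (?c - k *\<^sub>R n))\<^sup>2 = (norm ?c)\<^sup>2 - 2 * k * (n \<bullet> ?c) + k\<^sup>2 * (n \<bullet> n)" for k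
    unfolding power2_norm_eq_inner
    by (simp add: inner_diff_left inner_diff_right inner_commute power2_eq_square)
  moreover have "n \<bullet> n = 1" using n by (simp add: norm_eq_1)
  ultimately have "(norm (?c - (n \<bullet> ?c) *\<^sub>R n))\<^sup>2 = 0"
    by (simp add: power2_eq_square)
  then show ?thesis by simp
qed

lemma patch_derivative:
  assumes "(B, \<psi>) \<in> patches S" "y \<in> B"
  shows "(\<psi> has_derivative frechet_derivative \<psi> (at y)) (at y)"
proof -
  have B: "open B" "smooth_on B \<psi>" using assms by (auto simp: patches_def)
  obtain W g g' where "B \<subseteq> W" "C1_on W g g'" "\<forall>x\<in>B. g x = \<psi> x"
    using smooth_on_imp_C1_extension[OF B(2)] by blast
  then have "(\<psi> has_derivative g' y) (at y)"
    using has_derivative_interior[of W g g' B \<psi> y] assms(2) B(1) by (simp add: interior_open)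
  then show ?thesis by (metis frechet_derivative_at)
qed

text \<open>The tangent vectors of a patch are velocities of curves in \<open>S\<close>, so the cross product is normal
  to \<open>S\<close>. With \<open>v\<close> the direction of projection, the left-hand side is the Jacobian of the patch followed
  by the projection.\<close>

lemma patch_cross_parallel_normal:
  assumes P: "(B, \<psi>) \<in> patches S" and y: "y \<in> B" and N: "oriented_surface S N"
  shows "\<bar>cross3 (partial_deriv 1 \<psi> y) (partial_deriv 2 \<psi> y) \<bullet> v\<bar>
    = norm (cross3 (partial_deriv 1 \<psi> y) (partial_deriv 2 \<psi> y)) * \<bar>N (\<psi> y) \<bullet> v\<bar>"
proof -
  have B: "open B" "\<psi> ` B \<subseteq> S" using P by (auto simp: patches_def)
  then have S: "\<psi> y \<in> S" using y by blast
  obtain r where r: "r > 0" "ball y r \<subseteq> B" using B(1) y by (meson openE)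
  have "partial_deriv i \<psi> y \<in> tangent_space S (\<psi> y)" for i
    unfolding partial_deriv_def
  proof (rule velocity_in_tangent_space[OF patch_derivative[OF P y], of "r/2"])
    fix t :: real assume "0 \<le> t" "t \<le> r/2"
    then have "y + t *\<^sub>R axis i 1 \<in> ball y r" using r(1) by (simp add: dist_norm)
    then show "\<psi> (y + t *\<^sub>R axis i 1) \<in> S" using r(2) B(2) by blast
  qed (use r in auto)
  then have "N (\<psi> y) \<bullet> partial_deriv i \<psi> y = 0" for i
    using N S by (auto simp: oriented_surface_def)
  moreover have n: "norm (N (\<psi> y)) = 1" using N S by (auto simp: oriented_surface_def)
  ultimately have c: "cross3 (partial_deriv 1 \<psi> y) (partial_deriv 2 \<psi> y)
     = (N (\<psi> y) \<bullet> cross3 (partial_deriv 1 \<psi> y) (partial_deriv 2 \<psi> y)) *\<^sub>R N (\<psi> y)" (is "?c = ?k *\<^sub>R _")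
    by (intro cross_parallel_normal) auto
  have "norm ?c = \<bar>?k\<bar>" by (subst c) (simp add: n)
  moreover have "\<bar>?c \<bullet> v\<bar> = \<bar>?k\<bar> * \<bar>N (\<psi> y) \<bullet> v\<bar>" by (subst c) (simp add: abs_mult)
  ultimately show ?thesis by simp
qed

definition plane_coords :: "real^3 \<Rightarrow> real^3 \<Rightarrow> real^3 \<Rightarrow> real^2" where
  "plane_coords e1 e2 x = vector [x \<bullet> e1, x \<bullet> e2]"

lemma bounded_linear_plane_coords: "bounded_linear (plane_coords e1 e2)"
proof -
  have "plane_coords e1 e2 = (\<lambda>x. (x \<bullet> e1) *\<^sub>R axis 1 1 + (x \<bullet> e2) *\<^sub>R axis 2 1)"
    by (simp add: plane_coords_def vector_2_axis fun_eq_iff)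
  then show ?thesis
    by (auto intro!: bounded_linear_add bounded_linear_scaleR_const bounded_linear_inner_left)
qed

text \<open>This is the Binet--Cauchy identity.\<close>

lemma det_plane_coords:
  "det (matrix (\<lambda>h. plane_coords e1 e2 (f h))) = cross3 (f (axis 1 1)) (f (axis 2 1)) \<bullet> cross3 e1 e2"
proof -
  have "det (matrix (\<lambda>h. plane_coords e1 e2 (f h)))
    = (f (axis 1 1) \<bullet> e1) * (f (axis 2 1) \<bullet> e2) - (f (axis 2 1) \<bullet> e1) * (f (axis 1 1) \<bullet> e2)"
    by (simp add: det_2 matrix_def plane_coords_def)
  then show ?thesis by (simp add: cross3_simps)
qed

text \<open>The density of the area with respect to the area of the projection is \<open>1 / |N \<bullet> v|\<close>,
  where \<open>v = e\<^sub>1 \<times> e\<^sub>2\<close>, by the change of variables formula. Since \<open>F\<close> is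
  integrable over the whole projection of \<open>S\<close>, the integral over any patch is finite,
  also when its domain is unbounded.\<close>

lemma patch_integral_eq_projected_integral:
  fixes e1 e2 :: "real^3" and S :: "(real^3) set" and f :: "real^3 \<Rightarrow> real" and N :: "real^3 \<Rightarrow> real^3"
  defines "q \<equiv> plane_coords e1 e2"
  defines "F \<equiv> (\<lambda>z. f (inv_into S q z) / \<bar>N (inv_into S q z) \<bullet> cross3 e1 e2\<bar>)"
  assumes S: "compact S" and inj: "inj_on q S" and N: "oriented_surface S N"
    and nz: "\<forall>p\<in>S. N p \<bullet> cross3 e1 e2 \<noteq> 0"
    and f: "continuous_on S f" "\<forall>p\<in>S. 0 \<le> f p"
  shows "F absolutely_integrable_on (q ` S)" "\<And>z. z \<in> q ` S \<Longrightarrow> 0 \<le> F z"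
    and "(B, \<psi>) \<in> patches S \<Longrightarrow> F integrable_on (q ` \<psi> ` B)"
    and "(B, \<psi>) \<in> patches S \<Longrightarrow> (\<integral>\<^sup>+y\<in>B. ennreal (f (\<psi> y) *
         norm (cross3 (partial_deriv 1 \<psi> y) (partial_deriv 2 \<psi> y))) \<partial>lborel) = ennreal (integral (q ` \<psi> ` B) F)"
proof -
  note q = bounded_linear_plane_coords[of e1 e2, folded q_def]
  have qc: "continuous_on S q" using q by (rule linear_continuous_on)
  have G: "inv_into S q (q p) = p" if "p \<in> S" for p using inj that by simp
  have "continuous_on (q ` S) (inv_into S q)"
    by (rule continuous_on_inv[OF qc S]) (simp add: G)
  then have "continuous_on (q ` S) F"
  proof -
    assume G': "continuous_on (q ` S) (inv_into S q)"
    have "continuous_on S (\<lambda>p. f p / \<bar>N p \<bullet> cross3 e1 e2\<bar>)"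
      using f(1) N nz by (intro continuous_intros) (auto simp: oriented_surface_def)
    then show ?thesis
      unfolding F_def by (rule continuous_on_compose2[OF _ G']) (auto simp: G)
  qed
  moreover have K: "compact (q ` S)" using qc S by (rule compact_continuous_image)
  ultimately show Fi: "F absolutely_integrable_on (q ` S)"
    by (intro absolutely_integrable_on_compact)
  show F0: "\<And>z. z \<in> q ` S \<Longrightarrow> 0 \<le> F z"
    using f(2) by (auto simp: F_def G)
  assume P: "(B, \<psi>) \<in> patches S"
  have B: "open B" "inj_on \<psi> B" "\<psi> ` B \<subseteq> S" using P by (auto simp: patches_def)
  let ?D = "\<lambda>y h. q (frechet_derivative \<psi> (at y) h)"
  have der: "((\<lambda>y. q (\<psi> y)) has_derivative ?D y) (at y within B)" if "y \<in> B" for y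
    using bounded_linear.has_derivative[OF q patch_derivative[OF P that]] by (rule has_derivative_at_withinI)
  have im: "(\<lambda>y. q (\<psi> y)) ` B = q ` \<psi> ` B" by auto
  have inj': "inj_on (\<lambda>y. q (\<psi> y)) B"
    using comp_inj_on[OF B(2) inj_on_subset[OF inj B(3)]] by (simp add: o_def)
  have Bl: "B \<in> sets lebesgue" using B(1) by auto
  have "(\<lambda>y. q (\<psi> y)) ` B \<in> sets lebesgue"
    using der by (intro differentiable_image_in_sets_lebesgue[OF Bl])
      (auto simp: differentiable_on_def differentiable_def)
  then have FB: "F absolutely_integrable_on (q ` \<psi> ` B)"
    using set_integrable_subset[OF Fi, of "q ` \<psi> ` B"] B(3) im by auto
  then show "F integrable_on (q ` \<psi> ` B)" by (rule set_lebesgue_integral_eq_integral(1))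
  have cov: "(\<lambda>y. \<bar>det (matrix (?D y))\<bar> * F (q (\<psi> y))) absolutely_integrable_on B"
    "integral B (\<lambda>y. \<bar>det (matrix (?D y))\<bar> * F (q (\<psi> y))) = integral (q ` \<psi> ` B) F"
    using has_absolute_integral_change_of_variables_scalar[OF Bl der inj', of F "integral (q ` \<psi> ` B) F"]
      FB im by auto
  have eq: "\<bar>det (matrix (?D y))\<bar> * F (q (\<psi> y)) = f (\<psi> y) * norm (cross3 (partial_deriv 1 \<psi> y) (partial_deriv 2 \<psi> y))"
    if y: "y \<in> B" for y
  proof -
    have p: "\<psi> y \<in> S" using B y by auto
    have "\<bar>det (matrix (?D y))\<bar> = norm (cross3 (partial_deriv 1 \<psi> y) (partial_deriv 2 \<psi> y)) * \<bar>N (\<psi> y) \<bullet> cross3 e1 e2\<bar>"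
      unfolding q_def det_plane_coords using patch_cross_parallel_normal[OF P y N, of "cross3 e1 e2"]
      by (simp add: partial_deriv_def)
    then show ?thesis using bspec[OF nz p] by (simp add: F_def G[OF p])
  qed
  have "((\<lambda>y. f (\<psi> y) * norm (cross3 (partial_deriv 1 \<psi> y) (partial_deriv 2 \<psi> y))) has_integral integral (q ` \<psi> ` B) F) B"
    using cov eq by (metis (no_types, lifting) has_integral_eq has_integral_integral set_lebesgue_integral_eq_integral(1))
  then show "(\<integral>\<^sup>+y\<in>B. ennreal (f (\<psi> y) *
         norm (cross3 (partial_deriv 1 \<psi> y) (partial_deriv 2 \<psi> y))) \<partial>lborel) = ennreal (integral (q ` \<psi> ` B) F)"
    using B f(2) by (intro nn_integral_has_integral_lebesgue') auto
qed

text \<open>All patches are measured by the same function \<open>F\<close> on the projection of \<open>S\<close>, so a family of disjoint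
  patches that covers almost everything attains the supremum.\<close>

lemma surface_integral_le_patch_sum:
  fixes e1 e2 :: "real^3" and S :: "(real^3) set" and f :: "real^3 \<Rightarrow> real" and N :: "real^3 \<Rightarrow> real^3"
  assumes S: "compact S" and inj: "inj_on (plane_coords e1 e2) S" and N: "oriented_surface S N"
    and nz: "\<And>p. p \<in> S \<Longrightarrow> N p \<bullet> cross3 e1 e2 \<noteq> 0"
    and f: "continuous_on S f" "\<And>p. p \<in> S \<Longrightarrow> 0 \<le> f p"
    and T: "finite T" "T \<subseteq> patches S" "pairwise (\<lambda>a b. disjnt (snd a ` fst a) (snd b ` fst b)) T"
    and null: "negligible (plane_coords e1 e2 ` S - (\<Union>(B, \<psi>)\<in>T. plane_coords e1 e2 ` \<psi> ` B))"
  shows "surface_integral S f \<le> (\<Sum>(B, \<psi>)\<in>T. \<integral>\<^sup>+y\<in>B. ennreal (f (\<psi> y) *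
         norm (cross3 (partial_deriv 1 \<psi> y) (partial_deriv 2 \<psi> y))) \<partial>lborel)"
proof -
  define q where "q = plane_coords e1 e2"
  define F where "F = (\<lambda>z. f (inv_into S q z) / \<bar>N (inv_into S q z) \<bullet> cross3 e1 e2\<bar>)"
  have "\<forall>p\<in>S. N p \<bullet> cross3 e1 e2 \<noteq> 0" "\<forall>p\<in>S. 0 \<le> f p" using nz f(2) by auto
  note I = patch_integral_eq_projected_integral[OF S inj N this(1) f(1) this(2), folded q_def, folded F_def]
  have F0: "0 \<le> F z" if "z \<in> q ` S" for z using I(2)[OF that] unfolding F_def .
  define A where "A P = q ` snd P ` fst P" for P :: "(real^2) set \<times> (real^2 \<Rightarrow> real^3)"
  have Ki: "F integrable_on q ` S" using I(1) by (rule set_lebesgue_integral_eq_integral(1))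
  have sum: "(\<Sum>(B, \<psi>)\<in>P. \<integral>\<^sup>+y\<in>B. ennreal (f (\<psi> y) *
         norm (cross3 (partial_deriv 1 \<psi> y) (partial_deriv 2 \<psi> y))) \<partial>lborel) = ennreal (integral (\<Union>a\<in>P. A a) F)"
    and int: "F integrable_on (\<Union>a\<in>P. A a)" and sub: "(\<Union>a\<in>P. A a) \<subseteq> q ` S"
    if P: "finite P" "P \<subseteq> patches S" "pairwise (\<lambda>a b. disjnt (snd a ` fst a) (snd b ` fst b)) P" for P
  proof -
    have AS: "snd a ` fst a \<subseteq> S" if "a \<in> P" for a
    proof -
      obtain B \<psi> where "a = (B, \<psi>)" by (cases a)
      moreover from this have "(B, \<psi>) \<in> patches S" using P(2) that by blast
      ultimately show ?thesis by (simp add: patches_def)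
    qed
    have "pairwise (\<lambda>a b. disjnt (A a) (A b)) P"
    proof (rule pairwiseI)
      fix a b assume ab: "a \<in> P" "b \<in> P" "a \<noteq> b"
      then have "disjnt (snd a ` fst a) (snd b ` fst b)" using P(3) by (simp add: pairwise_def)
      moreover have "q ` (snd a ` fst a) \<inter> q ` (snd b ` fst b) = q ` (snd a ` fst a \<inter> snd b ` fst b)"
        using inj_on_image_Int[OF inj[folded q_def] AS[OF ab(1)] AS[OF ab(2)]] by simp
      ultimately show "disjnt (A a) (A b)" by (simp add: A_def disjnt_def)
    qed
    moreover have Fa: "F integrable_on A a" if "a \<in> P" for a
      using I(3)[of "fst a" "snd a"] P(2) that by (auto simp: A_def)
    ultimately have hi: "(F has_integral (\<Sum>a\<in>P. integral (A a) F)) (\<Union>a\<in>P. A a)"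
      using P(1) by (intro has_integral_disjoint_UN) auto
    show "F integrable_on (\<Union>a\<in>P. A a)" using hi by blast
    show "(\<Union>a\<in>P. A a) \<subseteq> q ` S" unfolding A_def by (intro UN_least image_mono AS)
    have pos: "0 \<le> integral (A a) F" if "a \<in> P" for a
      using Fa[OF that] AS[OF that] by (intro integral_nonneg F0) (auto simp: A_def)
    have "(\<Sum>(B, \<psi>)\<in>P. \<integral>\<^sup>+y\<in>B. ennreal (f (\<psi> y) *
         norm (cross3 (partial_deriv 1 \<psi> y) (partial_deriv 2 \<psi> y))) \<partial>lborel) = (\<Sum>a\<in>P. ennreal (integral (A a) F))"
    proof (rule sum.cong[OF refl], clarify)
      fix B \<psi> assume "(B, \<psi>) \<in> P"
      then have "(B, \<psi>) \<in> patches S" using P(2) by blast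
      from I(4)[OF this] show "(\<integral>\<^sup>+y\<in>B. ennreal (f (\<psi> y) *
         norm (cross3 (partial_deriv 1 \<psi> y) (partial_deriv 2 \<psi> y))) \<partial>lborel) = ennreal (integral (A (B, \<psi>)) F)"
        by (simp add: A_def)
    qed
    also have "\<dots> = ennreal (\<Sum>a\<in>P. integral (A a) F)" using pos by (intro sum_ennreal) auto
    also have "(\<Sum>a\<in>P. integral (A a) F) = integral (\<Union>a\<in>P. A a) F"
      using hi by (simp add: integral_unique)
    finally show "(\<Sum>(B, \<psi>)\<in>P. \<integral>\<^sup>+y\<in>B. ennreal (f (\<psi> y) *
         norm (cross3 (partial_deriv 1 \<psi> y) (partial_deriv 2 \<psi> y))) \<partial>lborel) = ennreal (integral (\<Union>a\<in>P. A a) F)" .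
  qed
  have "integral (\<Union>a\<in>T. A a) F = integral (q ` S) F"
  proof (rule integral_subset_negligible)
    show "negligible (q ` S - (\<Union>a\<in>T. A a))"
      using null by (simp add: q_def A_def case_prod_unfold)
  qed (use sub[OF T] in auto)
  then have T_eq: "(\<Sum>(B, \<psi>)\<in>T. \<integral>\<^sup>+y\<in>B. ennreal (f (\<psi> y) *
         norm (cross3 (partial_deriv 1 \<psi> y) (partial_deriv 2 \<psi> y))) \<partial>lborel) = ennreal (integral (q ` S) F)"
    using sum[OF T] by simp
  show ?thesis
    unfolding surface_integral_def T_eq
  proof (rule SUP_least)
    fix P assume "P \<in> {P. finite P \<and> P \<subseteq> patches S \<and> pairwise (\<lambda>a b. disjnt (snd a ` fst a) (snd b ` fst b)) P}"
    then have P: "finite P" "P \<subseteq> patches S" "pairwise (\<lambda>a b. disjnt (snd a ` fst a) (snd b ` fst b)) P" by auto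
    show "(\<Sum>(B, \<psi>)\<in>P. \<integral>\<^sup>+y\<in>B. ennreal (f (\<psi> y) *
         norm (cross3 (partial_deriv 1 \<psi> y) (partial_deriv 2 \<psi> y))) \<partial>lborel) \<le> ennreal (integral (q ` S) F)"
      unfolding sum[OF P] by (intro ennreal_leI integral_subset_le sub[OF P] int[OF P] Ki ballI F0)
  qed
qed

lemma smooth_on_subset: "smooth_on K f \<Longrightarrow> L \<subseteq> K \<Longrightarrow> smooth_on L f"
  unfolding smooth_on_def by (meson order_trans subsetD)

section \<open>Flux through a triangulated surface\<close>

lemma bary2_surj: "bary2 ` solid_simplex2 = standard_simplex 2"
proof
  show "bary2 ` solid_simplex2 \<subseteq> standard_simplex 2" by (auto simp: solid_simplex2_def)
  show "standard_simplex 2 \<subseteq> bary2 ` solid_simplex2"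
  proof
    fix x assume x: "x \<in> standard_simplex 2"
    let ?y = "vector [x 1, x 2] :: real^2"
    have "x 0 + x 1 + x 2 = 1" using x by (simp add: standard_simplex_def numeral_2_eq_2)
    moreover have "x i = 0" if "i > 2" for i using x that by (simp add: standard_simplex_def)
    ultimately have "bary2 ?y = x" by (auto simp: bary2_def fun_eq_iff)
    with x show "x \<in> bary2 ` solid_simplex2" by (auto simp: solid_simplex2_def intro!: image_eqI[of _ _ ?y])
  qed
qed

lemma inj_bary2: "inj bary2"
proof (rule injI)
  fix x y assume "bary2 x = bary2 y"
  then have "bary2 x 1 = bary2 y 1" "bary2 x 2 = bary2 y 2" by auto
  then show "x = y" by (simp add: bary2_def vec_eq_iff forall_2)
qed

lemma interior_solid_simplex2_nonempty: "interior solid_simplex2 \<noteq> {}"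
proof -
  have "box 0 (vector [1/2, 1/2]) \<subseteq> solid_simplex2"
    by (auto simp: mem_box_cart forall_2 mem_solid_simplex2)
  then have "box 0 (vector [1/2, 1/2]) \<subseteq> interior solid_simplex2"
    by (rule interior_maximal) (rule open_box)
  moreover have "vector [1/4, 1/4] \<in> (box 0 (vector [1/2, 1/2]) :: (real^2) set)"
    by (simp add: mem_box_cart forall_2)
  ultimately show ?thesis by blast
qed

context
  fixes S N s
  assumes s: "fundamental_chain S N s" and N: "\<forall>p\<in>S. norm (N p) = 1" "continuous_on S N"
begin

abbreviation (input) tri :: "((nat \<Rightarrow> real) \<Rightarrow> real^3) \<Rightarrow> (real^2) set \<times> (real^2 \<Rightarrow> real^3)" where
  "tri \<sigma> \<equiv> (interior solid_simplex2, \<sigma> \<circ> bary2)"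

abbreviation (input) jac :: "((nat \<Rightarrow> real) \<Rightarrow> real^3) \<Rightarrow> real^2 \<Rightarrow> real^3" where
  "jac \<sigma> y \<equiv> cross3 (partial_deriv 1 (\<sigma> \<circ> bary2) y) (partial_deriv 2 (\<sigma> \<circ> bary2) y)"

lemma triangle_C1_extension:
  assumes "\<sigma> \<in> Poly_Mapping.keys s"
  obtains W g g' where "solid_simplex2 \<subseteq> W" "C1_on W g g'" "\<forall>x\<in>solid_simplex2. g x = \<sigma> (bary2 x)"
proof -
  have "smooth_on solid_simplex2 (\<sigma> \<circ> bary2)" using s assms by (simp add: fundamental_chain_def)
  from smooth_on_imp_C1_extension[OF this] show ?thesis
    using that by (auto simp: o_def)
qed

lemma triangle_in_surface:
  assumes "\<sigma> \<in> Poly_Mapping.keys s" "y \<in> solid_simplex2"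
  shows "\<sigma> (bary2 y) \<in> S"
  using s assms unfolding fundamental_chain_def solid_simplex2_def by blast

lemma triangle_interior_in_surface:
  assumes "\<sigma> \<in> Poly_Mapping.keys s" "y \<in> interior solid_simplex2"
  shows "\<sigma> (bary2 y) \<in> S"
  by (rule triangle_in_surface[OF assms(1) subsetD[OF interior_subset assms(2)]])

text \<open>Coefficient and normal both have absolute value one, which identifies the positive factor in the
  definition of the fundamental chain.\<close>

lemma triangle_oriented:
  assumes "\<sigma> \<in> Poly_Mapping.keys s" "y \<in> interior solid_simplex2"
  shows "of_int (Poly_Mapping.lookup s \<sigma>) *\<^sub>R jac \<sigma> y = norm (jac \<sigma> y) *\<^sub>R N (\<sigma> (bary2 y))" "jac \<sigma> y \<noteq> 0"
proof -
  let ?l = "of_int (Poly_Mapping.lookup s \<sigma>) :: real"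
  obtain r where r: "r > 0" "?l *\<^sub>R jac \<sigma> y = r *\<^sub>R N (\<sigma> (bary2 y))"
    using s assms unfolding fundamental_chain_def by blast
  have l: "\<bar>?l\<bar> = 1" using s assms unfolding fundamental_chain_def by fastforce
  have "y \<in> solid_simplex2" using assms(2) interior_subset by blast
  then have n: "norm (N (\<sigma> (bary2 y))) = 1" using N triangle_in_surface[OF assms(1)] by blast
  have "norm (?l *\<^sub>R jac \<sigma> y) = norm (r *\<^sub>R N (\<sigma> (bary2 y)))" using r(2) by simp
  then have "norm (jac \<sigma> y) = r" using r(1) l n by simp
  with r show "?l *\<^sub>R jac \<sigma> y = norm (jac \<sigma> y) *\<^sub>R N (\<sigma> (bary2 y))" "jac \<sigma> y \<noteq> 0" by auto
qed

lemma triangle_patch: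
  assumes "\<sigma> \<in> Poly_Mapping.keys s"
  shows "tri \<sigma> \<in> patches S"
proof -
  have sm: "smooth_on solid_simplex2 (\<sigma> \<circ> bary2)" "inj_on \<sigma> (standard_simplex 2)"
    using s assms by (auto simp: fundamental_chain_def)
  have sub: "bary2 ` interior solid_simplex2 \<subseteq> standard_simplex 2"
    unfolding bary2_surj[symmetric] using interior_subset by (rule image_mono)
  have "smooth_on (interior solid_simplex2) (\<sigma> \<circ> bary2)"
    using sm(1) interior_subset by (rule smooth_on_subset)
  moreover have "inj_on (\<sigma> \<circ> bary2) (interior solid_simplex2)"
    by (rule comp_inj_on[OF inj_on_subset[OF inj_bary2 subset_UNIV] inj_on_subset[OF sm(2) sub]])
  moreover have "(\<sigma> \<circ> bary2) ` interior solid_simplex2 \<subseteq> S"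
    using triangle_in_surface[OF assms] interior_subset by fastforce
  ultimately show ?thesis
    using triangle_oriented(2)[OF assms] by (simp add: patches_def)
qed

lemma triangles_disjoint:
  shows "inj_on tri (Poly_Mapping.keys s)"
    and "pairwise (\<lambda>a b. disjnt (snd a ` fst a) (snd b ` fst b)) (tri ` Poly_Mapping.keys s)"
proof -
  have p: "pairwise (\<lambda>\<sigma> \<tau>. disjnt ((\<sigma> \<circ> bary2) ` interior solid_simplex2) ((\<tau> \<circ> bary2) ` interior solid_simplex2)) (Poly_Mapping.keys s)"
    using s by (simp add: fundamental_chain_def)
  show "inj_on tri (Poly_Mapping.keys s)"
  proof (rule inj_onI, rule ccontr)
    fix \<sigma> \<tau> assume *: "\<sigma> \<in> Poly_Mapping.keys s" "\<tau> \<in> Poly_Mapping.keys s" "tri \<sigma> = tri \<tau>" "\<sigma> \<noteq> \<tau>"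
    have "\<sigma> \<circ> bary2 = \<tau> \<circ> bary2" using *(3) by (simp only: prod.inject)
    with pairwiseD[OF p *(1,2,4)]
    have "disjnt ((\<sigma> \<circ> bary2) ` interior solid_simplex2) ((\<sigma> \<circ> bary2) ` interior solid_simplex2)"
      by (simp only:)
    then show False using interior_solid_simplex2_nonempty by (simp add: disjnt_def)
  qed
  show "pairwise (\<lambda>a b. disjnt (snd a ` fst a) (snd b ` fst b)) (tri ` Poly_Mapping.keys s)"
    using p by (auto simp: pairwise_def)
qed

lemma sum_triangles: "sum G (tri ` Poly_Mapping.keys s) = (\<Sum>\<sigma>\<in>Poly_Mapping.keys s. G (tri \<sigma>))"
  by (subst sum.reindex[OF triangles_disjoint(1)]) (simp only: o_def)

lemma triangle_sum_le_surface_integral: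
  "(\<Sum>\<sigma>\<in>Poly_Mapping.keys s. \<integral>\<^sup>+y\<in>interior solid_simplex2. ennreal (f (\<sigma> (bary2 y)) * norm (jac \<sigma> y)) \<partial>lborel)
    \<le> surface_integral S f"
proof -
  have "(\<Sum>(B, \<psi>)\<in>tri ` Poly_Mapping.keys s. \<integral>\<^sup>+y\<in>B. ennreal (f (\<psi> y) *
         norm (cross3 (partial_deriv 1 \<psi> y) (partial_deriv 2 \<psi> y))) \<partial>lborel) \<le> surface_integral S f"
    unfolding surface_integral_def
    by (rule SUP_upper) (use triangle_patch triangles_disjoint(2) in auto)
  then show ?thesis
    by (simp add: sum_triangles)
qed

text \<open>What remains uncovered is contained in the image of the edges of the triangles, a
  differentiable image of a null set.\<close>

lemma projected_triangles_cover:
  assumes q: "bounded_linear q"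
  shows "negligible (q ` S - (\<Union>(B, \<psi>)\<in>tri ` Poly_Mapping.keys s. (q ` \<psi> ` B :: (real^2) set)))"
proof -
  let ?E = "solid_simplex2 - interior solid_simplex2"
  have E: "negligible ?E"
    using negligible_convex_frontier[OF convex_solid_simplex2]
    by (rule negligible_subset) (use closure_subset in \<open>auto simp: frontier_def\<close>)
  have neg: "negligible ((\<lambda>y. q (\<sigma> (bary2 y))) ` ?E)" if s': "\<sigma> \<in> Poly_Mapping.keys s" for \<sigma>
  proof -
    obtain W g g' where g: "solid_simplex2 \<subseteq> W" "C1_on W g g'" "\<forall>x\<in>solid_simplex2. g x = \<sigma> (bary2 x)"
      using triangle_C1_extension[OF s'] .
    have "(\<lambda>y. q (g y)) differentiable_on ?E"
      unfolding differentiable_on_def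
    proof
      fix y assume "y \<in> ?E"
      then have "y \<in> W" using g(1) by blast
      from bounded_linear.has_derivative[OF q C1_onD(2)[OF g(2) this]]
      show "(\<lambda>y. q (g y)) differentiable (at y within ?E)"
        by (rule differentiableI[OF has_derivative_at_withinI])
    qed
    then have "negligible ((\<lambda>y. q (g y)) ` ?E)"
      by (rule negligible_differentiable_image_negligible[OF order_refl E])
    moreover have "(\<lambda>y. q (g y)) ` ?E = (\<lambda>y. q (\<sigma> (bary2 y))) ` ?E"
      using g(3) by (intro image_cong) auto
    ultimately show ?thesis by simp
  qed
  have "negligible (\<Union>\<sigma>\<in>Poly_Mapping.keys s. (\<lambda>y. q (\<sigma> (bary2 y))) ` ?E)"
    using neg by (intro negligible_Union) auto
  moreover have "q ` S - (\<Union>(B, \<psi>)\<in>tri ` Poly_Mapping.keys s. q ` \<psi> ` B)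
      \<subseteq> (\<Union>\<sigma>\<in>Poly_Mapping.keys s. (\<lambda>y. q (\<sigma> (bary2 y))) ` ?E)"
  proof
    fix z assume z: "z \<in> q ` S - (\<Union>(B, \<psi>)\<in>tri ` Poly_Mapping.keys s. q ` \<psi> ` B)"
    have "S = (\<Union>\<sigma>\<in>Poly_Mapping.keys s. \<sigma> ` bary2 ` solid_simplex2)"
      unfolding bary2_surj using s by (simp add: fundamental_chain_def)
    with z obtain \<sigma> y where \<sigma>: "\<sigma> \<in> Poly_Mapping.keys s" and y: "y \<in> solid_simplex2" "z = q (\<sigma> (bary2 y))" by auto
    have "y \<notin> interior solid_simplex2"
    proof
      assume "y \<in> interior solid_simplex2"
      then have "z \<in> q ` (\<sigma> \<circ> bary2) ` interior solid_simplex2" using y(2) by auto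
      with z \<sigma> show False by auto
    qed
    with \<sigma> y show "z \<in> (\<Union>\<sigma>\<in>Poly_Mapping.keys s. (\<lambda>y. q (\<sigma> (bary2 y))) ` ?E)"
      by blast
  qed
  ultimately show ?thesis by (rule negligible_subset)
qed

lemma triangle_integrable:
  assumes s': "\<sigma> \<in> Poly_Mapping.keys s" and f: "continuous_on S f"
  shows "(\<lambda>y. f (\<sigma> (bary2 y)) * norm (jac \<sigma> y)) integrable_on interior solid_simplex2"
proof -
  obtain W g g' where g: "solid_simplex2 \<subseteq> W" "C1_on W g g'" "\<forall>x\<in>solid_simplex2. g x = \<sigma> (bary2 x)"
    using triangle_C1_extension[OF s'] .
  let ?h = "\<lambda>y. f (g y) * norm (cross3 (g' y (axis 1 1)) (g' y (axis 2 1)))"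
  have gS: "g ` solid_simplex2 \<subseteq> S" using g(3) triangle_in_surface[OF s'] by auto
  have "continuous_on solid_simplex2 ?h"
    using continuous_on_subset[OF C1_onD(3)[OF g(2)] g(1)]
    by (intro continuous_on_mult continuous_on_norm continuous_on_cross
        continuous_on_compose2[OF f continuous_on_subset[OF C1_onD(4)[OF g(2)] g(1)] gS]) auto
  then have "?h integrable_on solid_simplex2"
    by (intro set_borel_integral_eq_integral(1) set_integrable_lborel_compact compact_solid_simplex2)
  then have "?h integrable_on interior solid_simplex2"
    by (rule integrable_spike_set)
      (auto intro!: negligible_subset[OF negligible_convex_frontier[OF convex_solid_simplex2]]
        simp: frontier_def dest: subsetD[OF interior_subset] subsetD[OF closure_subset])
  moreover have "?h y = f (\<sigma> (bary2 y)) * norm (jac \<sigma> y)" if y: "y \<in> interior solid_simplex2" for y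
  proof -
    have "((\<sigma> \<circ> bary2) has_derivative g' y) (at y)"
      by (rule has_derivative_interior[OF g(2) g(1) _ y]) (use g(3) in auto)
    then have "partial_deriv i (\<sigma> \<circ> bary2) y = g' y (axis i 1)" for i by (rule partial_deriv_eqI)
    moreover have "y \<in> solid_simplex2" using y interior_subset by blast
    ultimately show ?thesis using g(3) by simp
  qed
  ultimately show ?thesis by (rule integrable_eq)
qed

lemma oriented_flux:
  assumes s': "\<sigma> \<in> Poly_Mapping.keys s"
  shows "of_int (Poly_Mapping.lookup s \<sigma>) * flux Y \<sigma>
    = integral (interior solid_simplex2) (\<lambda>y. (Y (\<sigma> (bary2 y)) \<bullet> N (\<sigma> (bary2 y))) * norm (jac \<sigma> y))"
  unfolding flux_def integral_mult_right[symmetric]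
proof (rule integral_cong)
  fix y assume y: "y \<in> interior solid_simplex2"
  have "of_int (Poly_Mapping.lookup s \<sigma>) * (Y (\<sigma> (bary2 y)) \<bullet> jac \<sigma> y)
      = Y (\<sigma> (bary2 y)) \<bullet> (of_int (Poly_Mapping.lookup s \<sigma>) *\<^sub>R jac \<sigma> y)" by simp
  then show "of_int (Poly_Mapping.lookup s \<sigma>) * (Y (\<sigma> (bary2 y)) \<bullet> jac \<sigma> y)
      = (Y (\<sigma> (bary2 y)) \<bullet> N (\<sigma> (bary2 y))) * norm (jac \<sigma> y)"
    unfolding triangle_oriented(1)[OF s' y] by simp
qed

lemma triangle_area_eq:
  assumes s': "\<sigma> \<in> Poly_Mapping.keys s" and f: "continuous_on S f" "\<And>p. p \<in> S \<Longrightarrow> 0 \<le> f p"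
  shows "(\<integral>\<^sup>+y\<in>interior solid_simplex2. ennreal (f (\<sigma> (bary2 y)) * norm (jac \<sigma> y)) \<partial>lborel)
    = ennreal (integral (interior solid_simplex2) (\<lambda>y. f (\<sigma> (bary2 y)) * norm (jac \<sigma> y)))"
proof (rule nn_integral_has_integral_lebesgue')
  show "0 \<le> f (\<sigma> (bary2 y)) * norm (jac \<sigma> y)" if "y \<in> interior solid_simplex2" for y
    using f(2) triangle_interior_in_surface[OF s' that] by simp
qed (use triangle_integrable[OF s' f(1)] in \<open>simp add: integrable_integral\<close>)

lemma triangle_area_nonneg:
  assumes s': "\<sigma> \<in> Poly_Mapping.keys s" and f: "continuous_on S f" "\<And>p. p \<in> S \<Longrightarrow> 0 \<le> f p"
  shows "0 \<le> integral (interior solid_simplex2) (\<lambda>y. f (\<sigma> (bary2 y)) * norm (jac \<sigma> y))"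
  using triangle_interior_in_surface[OF s']
  by (intro integral_nonneg triangle_integrable[OF s' f(1)] mult_nonneg_nonneg f(2)) auto

text \<open>Only the triangles enter the flux, and as a family of patches they give a lower bound for the
  supremum that defines the surface integral.\<close>

lemma chain_flux_le_surface_integral:
  assumes Y: "continuous_on S Y" "\<And>p. p \<in> S \<Longrightarrow> Y p \<bullet> N p \<le> f p"
    and f: "continuous_on S f" "\<And>p. p \<in> S \<Longrightarrow> 0 \<le> f p"
  shows "ennreal (chain_sum (flux Y) s) \<le> surface_integral S f"
proof -
  let ?a = "\<lambda>\<sigma>. integral (interior solid_simplex2) (\<lambda>y. f (\<sigma> (bary2 y)) * norm (jac \<sigma> y))"
  note a0 = triangle_area_nonneg[OF _ f]
  have "chain_sum (flux Y) s \<le> (\<Sum>\<sigma>\<in>Poly_Mapping.keys s. ?a \<sigma>)"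
    unfolding chain_sum_def
  proof (rule sum_mono)
    fix \<sigma> assume s': "\<sigma> \<in> Poly_Mapping.keys s"
    have "continuous_on S (\<lambda>p. Y p \<bullet> N p)" using Y(1) N(2) by (intro continuous_on_inner)
    then show "of_int (Poly_Mapping.lookup s \<sigma>) * flux Y \<sigma> \<le> ?a \<sigma>"
      unfolding oriented_flux[OF s'] using triangle_interior_in_surface[OF s']
      by (intro integral_le triangle_integrable[OF s', of "\<lambda>p. Y p \<bullet> N p"] triangle_integrable[OF s' f(1)]
          mult_right_mono Y(2)) auto
  qed
  then have "ennreal (chain_sum (flux Y) s) \<le> ennreal (\<Sum>\<sigma>\<in>Poly_Mapping.keys s. ?a \<sigma>)"
    by (rule ennreal_leI)
  also have "\<dots> = (\<Sum>\<sigma>\<in>Poly_Mapping.keys s. ennreal (?a \<sigma>))" by (simp add: sum_ennreal a0)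
  also have "\<dots> = (\<Sum>\<sigma>\<in>Poly_Mapping.keys s. \<integral>\<^sup>+y\<in>interior solid_simplex2. ennreal (f (\<sigma> (bary2 y)) * norm (jac \<sigma> y)) \<partial>lborel)"
    by (intro sum.cong refl triangle_area_eq[symmetric] f)
  also have "\<dots> \<le> surface_integral S f" by (rule triangle_sum_le_surface_integral)
  finally show ?thesis .
qed

text \<open>For a surface with injective projection the triangles attain that supremum.\<close>

lemma surface_integral_le_chain_flux:
  assumes S: "compact S" and inj: "inj_on (plane_coords e1 e2) S" and oS: "oriented_surface S N"
    and nz: "\<And>p. p \<in> S \<Longrightarrow> N p \<bullet> cross3 e1 e2 \<noteq> 0"
    and Y: "\<And>p. p \<in> S \<Longrightarrow> Y p \<bullet> N p = f p"
    and f: "continuous_on S f" "\<And>p. p \<in> S \<Longrightarrow> 0 \<le> f p"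
  shows "surface_integral S f \<le> ennreal (chain_sum (flux Y) s)"
proof -
  let ?a = "\<lambda>\<sigma>. integral (interior solid_simplex2) (\<lambda>y. f (\<sigma> (bary2 y)) * norm (jac \<sigma> y))"
  note a0 = triangle_area_nonneg[OF _ f]
  have "surface_integral S f \<le> (\<Sum>(B, \<psi>)\<in>tri ` Poly_Mapping.keys s. \<integral>\<^sup>+y\<in>B. ennreal (f (\<psi> y) *
         norm (cross3 (partial_deriv 1 \<psi> y) (partial_deriv 2 \<psi> y))) \<partial>lborel)"
    using triangle_patch triangles_disjoint(2) projected_triangles_cover[OF bounded_linear_plane_coords]
    by (intro surface_integral_le_patch_sum[OF S inj oS nz f]) auto
  also have "\<dots> = (\<Sum>\<sigma>\<in>Poly_Mapping.keys s. \<integral>\<^sup>+y\<in>interior solid_simplex2. ennreal (f (\<sigma> (bary2 y)) * norm (jac \<sigma> y)) \<partial>lborel)"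
    by (simp add: sum_triangles)
  also have "\<dots> = (\<Sum>\<sigma>\<in>Poly_Mapping.keys s. ennreal (?a \<sigma>))"
    by (intro sum.cong refl triangle_area_eq f)
  also have "\<dots> = ennreal (\<Sum>\<sigma>\<in>Poly_Mapping.keys s. ?a \<sigma>)" by (simp add: sum_ennreal a0)
  also have "(\<Sum>\<sigma>\<in>Poly_Mapping.keys s. ?a \<sigma>) = chain_sum (flux Y) s"
    unfolding chain_sum_def
  proof (rule sum.cong[OF refl])
    fix \<sigma> assume s': "\<sigma> \<in> Poly_Mapping.keys s"
    show "?a \<sigma> = of_int (Poly_Mapping.lookup s \<sigma>) * flux Y \<sigma>"
      unfolding oriented_flux[OF s'] using triangle_interior_in_surface[OF s']
      by (intro integral_cong) (simp add: Y)
  qed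
  finally show ?thesis .
qed

end

section \<open>Orthonormal frames and traces\<close>

lemma orthonormal_frame:
  fixes m :: "real^3"
  assumes m: "norm m = 1"
  obtains e1 e2 where "norm e1 = 1" "norm e2 = 1" "e1 \<bullet> e2 = 0" "e1 \<bullet> m = 0" "e2 \<bullet> m = 0" "cross3 e1 e2 = m"
proof -
  have "m \<noteq> 0" using m by auto
  then obtain i :: 3 where i: "cross3 m (axis i 1) \<noteq> 0"
    using cross_basis_nonzero[of m] by blast
  define e1 where "e1 = cross3 m (axis i 1) /\<^sub>R norm (cross3 m (axis i 1))"
  define e2 where "e2 = cross3 m e1"
  have e1: "norm e1 = 1" "e1 \<bullet> m = 0"
    using i by (auto simp: e1_def dot_cross_self)
  have e2: "e1 \<bullet> e2 = 0" "e2 \<bullet> m = 0" by (auto simp: e2_def dot_cross_self)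
  have "(norm e2)\<^sup>2 = 1"
    using norm_cross_dot[of m e1] m e1 by (simp add: e2_def inner_commute)
  then have "norm e2 = 1" using power2_eq_1_iff[of "norm e2"] norm_ge_zero[of e2] by linarith
  moreover have "cross3 e1 e2 = m"
    using e1 by (simp add: e2_def Lagrange norm_eq_1)
  ultimately show ?thesis using that e1 e2 by blast
qed

text \<open>The trace identity above, applied to the frame itself.\<close>

lemma divergence_orthonormal_frame:
  fixes m :: "real^3"
  assumes e: "norm e1 = 1" "norm e2 = 1" "e1 \<bullet> e2 = 0" "cross3 e1 e2 = m" "norm m = 1" and L: "linear (X' x)"
  shows "divergence X' x = X' x e1 \<bullet> e1 + X' x e2 \<bullet> e2 + X' x m \<bullet> m"
proof -
  have c: "cross3 e2 m = e1" "cross3 m e1 = e2"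
    using e(1-3) cross_skew[of m e1] unfolding e(4)[symmetric]
    by (simp_all add: Lagrange norm_eq_1 inner_commute)
  show ?thesis
    using trace_cross_identity[OF L, of e1 e2 m] e by (simp add: c divergence_def norm_eq_1)
qed

section \<open>The Gauss map of a graph\<close>

text \<open>The chain rule along a curve in \<open>S\<close> determines a derivative within \<open>S\<close> on velocities, hence on their
  span. This permits computing the mean curvature with an extension of \<open>N\<close> to the ambient space.\<close>

lemma derivative_unique_on_tangent_space:
  fixes N :: "real^3 \<Rightarrow> 'b::real_normed_vector"
  assumes D: "(N has_derivative D) (at p within S)" and E: "(N has_derivative E) (at p within S)"
    and w: "w \<in> tangent_space S p"
  shows "D w = E w"
proof -
  have "D w = E w" if "\<gamma> 0 = p" "\<gamma> ` {0..1} \<subseteq> S" "(\<gamma> has_vector_derivative w) (at 0 within {0..1})"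
    for w and \<gamma> :: "real \<Rightarrow> real^3"
  proof -
    have "((\<lambda>t. N (\<gamma> t)) has_vector_derivative F w) (at 0 within {0..1})"
      if F: "(N has_derivative F) (at p within S)" for F
    proof -
      have "(N has_derivative F) (at (\<gamma> 0) within \<gamma> ` {0..1})"
        using has_derivative_subset[OF F \<open>\<gamma> ` {0..1} \<subseteq> S\<close>] \<open>\<gamma> 0 = p\<close> by simp
      from has_derivative_in_compose[OF \<open>(\<gamma> has_vector_derivative w) (at 0 within {0..1})\<close>[unfolded has_vector_derivative_def] this]
      show ?thesis
        unfolding has_vector_derivative_def using has_derivative_linear[OF F] by (simp add: linear_cmul)
    qed
    from this[OF D] this[OF E] show ?thesis
      by (intro vector_derivative_unique_within_closed_interval[of 0 1 0 "\<lambda>t. N (\<gamma> t)"]) auto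
  qed
  then have "linear D" "linear E" "\<And>x. x \<in> {w. \<exists>\<gamma>::real \<Rightarrow> real^3. \<gamma> 0 = p \<and> \<gamma> ` {0..1} \<subseteq> S \<and>
     (\<gamma> has_vector_derivative w) (at 0 within {0..1})} \<Longrightarrow> D x = E x"
    using D E has_derivative_linear by blast+
  from linear_eq_on_span[OF this w[unfolded tangent_space_def]] show ?thesis .
qed

lemma C1_on_normalize:
  fixes n :: "'a::euclidean_space \<Rightarrow> 'b::euclidean_space"
  assumes n: "C1_on W n n'" "\<And>x. x \<in> W \<Longrightarrow> n x \<noteq> 0"
  shows "\<exists>m'. C1_on W (\<lambda>x. n x /\<^sub>R norm (n x)) m'"
proof -
  have 1: "C1_on {0<..} (\<lambda>r::real. inverse (sqrt r)) (\<lambda>r h. - (inverse (sqrt r) * (h * (inverse (sqrt r) / 2)) * inverse (sqrt r)))"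
    unfolding C1_on_def by (auto intro!: derivative_eq_intros continuous_intros)
  note 2 = C1_on_compose[OF bounded_bilinear.C1_on[OF bounded_bilinear_inner n(1) n(1)] 1]
  have "(\<lambda>x. n x \<bullet> n x) ` W \<subseteq> {0<..}" using n(2) by auto
  from bounded_bilinear.C1_on[OF bounded_bilinear_scaleR 2[OF this] n(1)]
  show ?thesis unfolding norm_eq_sqrt_inner by blast
qed

lemma C1_on_unit_field:
  assumes X: "C1_on V X X'" and unit: "\<And>x. x \<in> V \<Longrightarrow> norm (X x) = 1" and x: "x \<in> V"
  shows "X' x h \<bullet> X x = 0"
proof -
  have "((\<lambda>x. X x \<bullet> X x) has_derivative (\<lambda>h. X x \<bullet> X' x h + X' x h \<bullet> X x)) (at x)"
    using C1_onD(2)[OF X x] by (auto intro!: derivative_eq_intros)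
  moreover have "((\<lambda>x. X x \<bullet> X x) has_derivative (\<lambda>h. 0)) (at x)"
    by (rule has_derivative_transform_within_open[OF has_derivative_const C1_onD(1)[OF X] x, of 1])
      (use unit in \<open>auto simp: norm_eq_1\<close>)
  ultimately have "(\<lambda>h. X x \<bullet> X' x h + X' x h \<bullet> X x) = (\<lambda>h. 0)"
    by (rule has_derivative_unique)
  from fun_cong[OF this, of h] show ?thesis by (simp add: inner_commute)
qed

definition plane_proj :: "real^3 \<Rightarrow> real \<Rightarrow> real^3 \<Rightarrow> real^3" where
  "plane_proj v c x = x - (x \<bullet> v - c) *\<^sub>R v"

lemma plane_proj_line: "norm v = 1 \<Longrightarrow> p \<bullet> v = c \<Longrightarrow> plane_proj v c (p + t *\<^sub>R v) = p"
  by (simp add: plane_proj_def inner_add_left norm_eq_1)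

lemma C1_on_plane_proj: "C1_on UNIV (plane_proj v c) (\<lambda>x h. h - (h \<bullet> v) *\<^sub>R v)"
  unfolding C1_on_def plane_proj_def by (auto intro!: derivative_eq_intros)

text \<open>For a height function with derivative \<open>g'\<close> this is \<open>v\<close> minus the gradient of the height
  along the plane. The component of the gradient in direction \<open>v\<close> is removed, as it only
  depends on how the height was extended off the plane.\<close>

definition graph_normal :: "real^3 \<Rightarrow> (real^3 \<Rightarrow> real^3 \<Rightarrow> real) \<Rightarrow> real^3 \<Rightarrow> real^3" where
  "graph_normal v g' z = (let w = \<Sum>b\<in>Basis. g' z b *\<^sub>R b in v - (w - (w \<bullet> v) *\<^sub>R v))"

lemma graph_normal_inner:
  assumes v: "norm v = 1" and lin: "linear (g' z)"
  shows "graph_normal v g' z \<bullet> v = 1" "h \<bullet> v = 0 \<Longrightarrow> graph_normal v g' z \<bullet> h = - g' z h"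
    "graph_normal v g' z \<noteq> 0"
proof -
  let ?w = "\<Sum>b\<in>Basis. g' z b *\<^sub>R b"
  have w: "?w \<bullet> h = g' z h" for h
  proof -
    have "?w \<bullet> h = (\<Sum>b\<in>Basis. (h \<bullet> b) *\<^sub>R g' z b)"
      by (simp add: inner_sum_left) (simp add: inner_commute mult.commute)
    then show ?thesis by (simp only: linear_basis_expansion[OF lin, of h])
  qed
  show 1: "graph_normal v g' z \<bullet> v = 1"
    using v by (simp add: graph_normal_def Let_def inner_diff_left norm_eq_1)
  show "h \<bullet> v = 0 \<Longrightarrow> graph_normal v g' z \<bullet> h = - g' z h"
    by (simp add: graph_normal_def Let_def inner_diff_left w inner_commute[of v h])
  show "graph_normal v g' z \<noteq> 0" using 1 by auto
qed

lemma C1_on_graph_normal: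
  assumes W: "open W" and g: "\<And>h. C1_on W (\<lambda>x. g' x h) (\<lambda>x. g'' x h)"
  shows "\<exists>n'. C1_on W (graph_normal v g') n'"
proof -
  have w: "C1_on W (\<lambda>z. \<Sum>b\<in>Basis. g' z b *\<^sub>R b) (\<lambda>z h. \<Sum>b\<in>Basis. g'' z b h *\<^sub>R b)"
    by (rule C1_on_sum[OF W], rule C1_on_bounded_linear[OF bounded_linear_scaleR_left], rule g)
  have L: "bounded_linear (\<lambda>w::real^3. (w \<bullet> v) *\<^sub>R v - w)"
    by (intro bounded_linear_sub bounded_linear_scaleR_const bounded_linear_inner_left bounded_linear_ident)
  from C1_on_add[OF C1_on_const[OF W, of v] C1_on_bounded_linear[OF L w]] show ?thesis
    unfolding graph_normal_def[abs_def] Let_def by (simp add: algebra_simps) blast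
qed

context
  fixes v :: "real^3" and c lam :: real and U D W S :: "(real^3) set"
    and g :: "real^3 \<Rightarrow> real" and g' g'' and N :: "real^3 \<Rightarrow> real^3"
  assumes v: "norm v = 1"
    and D: "openin (top_of_set {x. x \<bullet> v = c}) D" "connected D" "U = closure D"
    and g: "C1_on W g g'" "\<And>h. C1_on W (\<lambda>x. g' x h) (\<lambda>x. g'' x h)" and W: "U \<subseteq> W"
    and S: "S = (\<lambda>p. p + g p *\<^sub>R v) ` U"
    and N: "oriented_surface S N"
begin

abbreviation (input) lift :: "real^3 \<Rightarrow> real^3" where "lift p \<equiv> p + g p *\<^sub>R v"
abbreviation (input) nrm :: "real^3 \<Rightarrow> real^3" where "nrm \<equiv> graph_normal v g'"

lemma domain_in_plane: "p \<in> U \<Longrightarrow> p \<bullet> v = c"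
proof -
  have "D \<subseteq> {x. x \<bullet> v = c}" using openin_imp_subset[OF D(1)] by simp
  then have "U \<subseteq> {x. x \<bullet> v = c}"
    unfolding D(3) by (rule closure_minimal) (use closed_hyperplane[of v c] in \<open>simp add: inner_commute\<close>)
  then show "p \<in> U \<Longrightarrow> p \<bullet> v = c" by auto
qed

lemma open_part_subset: "D \<subseteq> U" unfolding D(3) by (rule closure_subset)

lemma graph_tangent_vector:
  assumes p: "p \<in> D" and h: "h \<bullet> v = 0"
  shows "h + g' p h *\<^sub>R v \<in> tangent_space S (lift p)"
proof -
  have pW: "p \<in> W" using p open_part_subset W by blast
  obtain e where e: "e > 0" "ball p e \<inter> {x. x \<bullet> v = c} \<subseteq> D"
    using D(1) p unfolding openin_contains_ball by blast
  define r where "r = e / (2 * (norm h + 1))"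
  have r: "r > 0" using e by (simp add: r_def add_nonneg_pos)
  have in_D: "p + t *\<^sub>R h \<in> D" if t: "0 \<le> t" "t \<le> r" for t
  proof -
    have "norm (t *\<^sub>R h) \<le> r * norm h" using t by (simp add: mult_right_mono)
    also have "\<dots> \<le> r * (norm h + 1)" using r by simp
    also have "\<dots> = e / 2" using add_nonneg_pos[of "norm h" 1] by (simp add: r_def field_simps)
    finally have "dist p (p + t *\<^sub>R h) < e" using e(1) by (simp add: dist_norm)
    moreover have "(p + t *\<^sub>R h) \<bullet> v = c"
      using domain_in_plane[of p] p open_part_subset h by (auto simp: inner_add_left)
    ultimately show ?thesis using e(2) by auto
  qed
  have "((\<lambda>x. x + g x *\<^sub>R v) has_derivative (\<lambda>h. h + g' p h *\<^sub>R v)) (at p)"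
    using C1_onD(2)[OF g(1) pW] by (auto intro!: derivative_eq_intros)
  then show ?thesis
    by (rule velocity_in_tangent_space[OF _ r]) (use in_D open_part_subset S in blast)
qed

text \<open>The vector \<open>h = N - (N \<bullet> v) n\<close> is horizontal, where \<open>n\<close> is the graph normal. Since \<open>N\<close> and \<open>n\<close> are both
  orthogonal to the tangent vector over \<open>h\<close>, so is \<open>h\<close>, and this means \<open>h \<bullet> h = 0\<close>.\<close>

lemma gauss_map_parallel_graph_normal:
  assumes p: "p \<in> D"
  shows "N (lift p) = (N (lift p) \<bullet> v) *\<^sub>R nrm p"
proof -
  let ?m = "N (lift p)"
  have pW: "p \<in> W" using p open_part_subset W by blast
  note n = graph_normal_inner[where g' = g', OF v C1_onD(5)[OF g(1) pW]]
  let ?h = "?m - (?m \<bullet> v) *\<^sub>R nrm p"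
  have h: "?h \<bullet> v = 0" by (simp add: inner_diff_left n)
  have "lift p \<in> S" using S p open_part_subset by blast
  then have "?m \<bullet> (?h + g' p ?h *\<^sub>R v) = 0"
    using N graph_tangent_vector[OF p h] unfolding oriented_surface_def by blast
  moreover have "nrm p \<bullet> ?h = - g' p ?h" by (rule n(2)[OF h])
  ultimately have "?h \<bullet> ?h = 0"
    by (simp add: inner_diff_left inner_add_right mult.commute)
  then show ?thesis by simp
qed

lemma graph_tangent_space:
  assumes p: "p \<in> D" and e: "e \<bullet> nrm p = 0"
  shows "e \<in> tangent_space S (lift p)"
proof -
  have pW: "p \<in> W" using p open_part_subset W by blast
  note n = graph_normal_inner[where g' = g', OF v C1_onD(5)[OF g(1) pW]]
  let ?h = "e - (e \<bullet> v) *\<^sub>R v"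
  have h: "?h \<bullet> v = 0" using v by (simp add: inner_diff_left norm_eq_1)
  have "nrm p \<bullet> ?h = - g' p ?h" by (rule n(2)[OF h])
  then have "g' p ?h = e \<bullet> v" using e n(1) by (simp add: inner_diff_right inner_commute)
  then show ?thesis using graph_tangent_vector[OF p h] by simp
qed

lemma continuous_on_lift: "continuous_on U lift"
  using continuous_on_subset[OF C1_onD(4)[OF g(1)] W] by (intro continuous_intros)

lemma continuous_on_gauss_map_lift: "continuous_on U (\<lambda>p. N (lift p))"
  using N S by (intro continuous_on_compose2[OF _ continuous_on_lift]) (auto simp: oriented_surface_def)

text \<open>The Gauss map is the upward or the downward unit normal, with the same choice
  everywhere because the domain is connected.\<close>

lemma gauss_map_graph:
  "\<exists>\<epsilon>. (\<epsilon> = 1 \<or> \<epsilon> = -1) \<and> (\<forall>p\<in>U. N (lift p) = \<epsilon> *\<^sub>R (nrm p /\<^sub>R norm (nrm p)))"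
proof -
  let ?a = "\<lambda>p. N (lift p) \<bullet> v"
  have lS: "lift p \<in> S" if "p \<in> U" for p using that S by blast
  have unit: "norm (N (lift p)) = 1" if "p \<in> U" for p
    using lS[OF that] N by (simp add: oriented_surface_def)
  have a0: "?a p \<noteq> 0" if "p \<in> D" for p
    using gauss_map_parallel_graph_normal[OF that] unit[of p] that open_part_subset by auto
  have "continuous_on D ?a"
    by (intro continuous_on_inner continuous_on_const continuous_on_subset[OF continuous_on_gauss_map_lift open_part_subset])
  then have con: "connected (?a ` D)" using D(2) by (rule connected_continuous_image)
  have "(\<forall>p\<in>D. ?a p > 0) \<or> (\<forall>p\<in>D. ?a p < 0)"
  proof (rule ccontr)
    assume "\<not> ?thesis"
    then obtain p q where pq: "p \<in> D" "q \<in> D" "?a p \<le> 0" "0 \<le> ?a q" by (auto simp: not_less)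
    have "0 \<in> ?a ` D"
      by (rule connectedD_interval[OF con imageI[OF pq(1)] imageI[OF pq(2)] pq(3,4)])
    then obtain r where "r \<in> D" "?a r = 0" by auto
    then show False using a0 by blast
  qed
  then obtain \<epsilon> :: real where \<epsilon>: "\<epsilon> = 1 \<or> \<epsilon> = -1" "\<And>p. p \<in> D \<Longrightarrow> \<epsilon> * ?a p = \<bar>?a p\<bar>"
  proof
    assume "\<forall>p\<in>D. ?a p > 0" then show thesis by (intro that[of 1]) auto
  next
    assume "\<forall>p\<in>D. ?a p < 0" then show thesis by (intro that[of "-1"]) auto
  qed
  have nD: "nrm z \<noteq> 0" if "z \<in> W" for z
    by (rule graph_normal_inner(3)[where g' = g', OF v C1_onD(5)[OF g(1) that]])
  have eqD: "N (lift p) = \<epsilon> *\<^sub>R (nrm p /\<^sub>R norm (nrm p))" if p: "p \<in> D" for p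
  proof -
    have pU: "p \<in> U" using p open_part_subset by blast
    have n0: "norm (nrm p) \<noteq> 0" using nD[of p] pU W by auto
    have "\<bar>?a p\<bar> * norm (nrm p) = 1"
      using arg_cong[OF gauss_map_parallel_graph_normal[OF p], of norm] unit[OF pU]
      by (simp only: norm_scaleR)
    then have "\<epsilon> * ?a p = inverse (norm (nrm p))" using n0 \<epsilon>(2)[OF p] by (simp add: field_simps)
    then have "?a p = \<epsilon> * inverse (norm (nrm p))" using \<epsilon>(1) by auto
    then show ?thesis using gauss_map_parallel_graph_normal[OF p] by simp
  qed
  obtain n' where n': "C1_on W nrm n'" using C1_on_graph_normal[where g' = g', OF C1_onD(1)[OF g(1)] g(2)] by blast
  have "continuous_on U (\<lambda>p. N (lift p) - \<epsilon> *\<^sub>R (nrm p /\<^sub>R norm (nrm p)))"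
    using nD W
    by (intro continuous_on_diff continuous_on_gauss_map_lift continuous_on_scaleR continuous_on_const
        continuous_on_inverse continuous_on_norm continuous_on_subset[OF C1_onD(4)[OF n'] W]) auto
  then have "N (lift p) - \<epsilon> *\<^sub>R (nrm p /\<^sub>R norm (nrm p)) = 0" if "p \<in> U" for p
    using continuous_constant_on_closure[of D "\<lambda>p. N (lift p) - \<epsilon> *\<^sub>R (nrm p /\<^sub>R norm (nrm p))" 0 p] eqD that
    by (simp add: D(3))
  then show ?thesis using \<epsilon>(1) by (intro exI[of _ \<epsilon>]) auto
qed

text \<open>At a graph point the divergence of the translated Gauss map \<open>X\<close> is the trace of its derivative
  over a frame consisting of two tangent vectors and \<open>N\<close>. The tangential part is \<open>- H\<close>, and the normal
  part vanishes because \<open>X\<close> has constant length. Invariance under translation along \<open>v\<close>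
  carries the value to the whole line over each point of the open part of the domain, and continuity to the lines over its
  boundary.\<close>

lemma translated_gauss_map:
  assumes sol: "\<And>p. p \<in> S \<Longrightarrow> has_mean_curvature S N p (N p \<bullet> v + lam)"
  shows "\<exists>V X X'. C1_on V X X' \<and> cylinder v U \<subseteq> V \<and> (\<forall>x\<in>V. norm (X x) = 1) \<and>
     (\<forall>p\<in>S. X p = N p \<and> N p \<bullet> v \<noteq> 0) \<and> (\<forall>x\<in>cylinder v U. divergence X' x = - (X x \<bullet> v + lam))"
proof -
  note oW = C1_onD(1)[OF g(1)]
  let ?P = "plane_proj v c"
  obtain \<epsilon> :: real where \<epsilon>: "\<epsilon> = 1 \<or> \<epsilon> = -1"
    "\<And>p. p \<in> U \<Longrightarrow> N (lift p) = \<epsilon> *\<^sub>R (nrm p /\<^sub>R norm (nrm p))"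
    using gauss_map_graph by blast
  have n: "nrm z \<bullet> v = 1" "nrm z \<noteq> 0" if "z \<in> W" for z
    using graph_normal_inner[where g' = g', OF v C1_onD(5)[OF g(1) that]] by auto
  obtain n' where n': "C1_on W nrm n'" using C1_on_graph_normal[where g' = g', OF oW g(2)] by blast
  obtain m' where m': "C1_on W (\<lambda>z. nrm z /\<^sub>R norm (nrm z)) m'"
    using C1_on_normalize[OF n' n(2)] by blast
  define X0 where "X0 z = \<epsilon> *\<^sub>R (nrm z /\<^sub>R norm (nrm z))" for z
  define X0' where "X0' z h = \<epsilon> *\<^sub>R m' z h" for z h
  have X0: "C1_on W X0 X0'"
    unfolding X0_def X0'_def by (rule C1_on_bounded_linear[OF bounded_linear_scaleR_right m'])
  define V where "V = ?P -` W"
  define X where "X x = X0 (?P x)" for x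
  define X' where "X' x h = X0' (?P x) (h - (h \<bullet> v) *\<^sub>R v)" for x h
  have oV: "open V"
    unfolding V_def using continuous_open_preimage[OF C1_onD(4)[OF C1_on_plane_proj] open_UNIV oW] by simp
  have X: "C1_on V X X'"
    unfolding X_def X'_def
    by (rule C1_on_compose[OF C1_on_subset[OF C1_on_plane_proj oV subset_UNIV] X0]) (auto simp: V_def)
  have proj: "?P (p + t *\<^sub>R v) = p" if "p \<in> U" for p t
    by (rule plane_proj_line[OF v domain_in_plane[OF that]])
  have proj0: "?P p = p" if "p \<in> U" for p using proj[OF that, of 0] by simp
  have cyl: "cylinder v U \<subseteq> V"
    using proj W by (auto simp: cylinder_def V_def)
  have unit: "norm (X x) = 1" if "x \<in> V" for x
    using that \<epsilon>(1) n(2)[of "?P x"] by (auto simp: X_def X0_def V_def)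
  have XN: "X p = N p" if "p \<in> S" for p
    using that \<epsilon>(2) proj by (auto simp: S X_def X0_def)
  have Nv: "N p \<bullet> v \<noteq> 0" if "p \<in> S" for p
    using that \<epsilon> n W by (auto simp: S)
  have SV: "S \<subseteq> V" using cyl by (force simp: S cylinder_def)
  have divD: "divergence X' p + X p \<bullet> v + lam = 0" if p: "p \<in> D" for p
  proof -
    let ?q = "lift p"
    have pU: "p \<in> U" using p open_part_subset by blast
    have q: "?q \<in> S" using S pU by blast
    then have qV: "?q \<in> V" using SV by blast
    have m: "norm (N ?q) = 1" using q N by (simp add: oriented_surface_def)
    obtain e1 e2 where e: "norm e1 = 1" "norm e2 = 1" "e1 \<bullet> e2 = 0" "e1 \<bullet> N ?q = 0" "e2 \<bullet> N ?q = 0" "cross3 e1 e2 = N ?q"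
      using orthonormal_frame[OF m] .
    have tan: "e \<in> tangent_space S ?q" if "e \<bullet> N ?q = 0" for e
    proof (rule graph_tangent_space[OF p])
      have "norm (nrm p) \<noteq> 0" using n(2)[of p] pU W by auto
      then show "e \<bullet> nrm p = 0" using that \<epsilon> by (auto simp: \<epsilon>(2)[OF pU])
    qed
    obtain E where E: "(N has_derivative E) (at ?q within S)"
      and H: "\<And>e1 e2. e1 \<in> tangent_space S ?q \<Longrightarrow> e2 \<in> tangent_space S ?q \<Longrightarrow> norm e1 = 1 \<Longrightarrow> norm e2 = 1 \<Longrightarrow> e1 \<bullet> e2 = 0 \<Longrightarrow>
        N ?q \<bullet> v + lam = (- E e1) \<bullet> e1 + (- E e2) \<bullet> e2"
      using sol[OF q] unfolding has_mean_curvature_def by blast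
    have "(N has_derivative X' ?q) (at ?q within S)"
      by (rule has_derivative_transform[OF q _ has_derivative_at_withinI[OF C1_onD(2)[OF X qV]]]) (simp add: XN)
    then have EX: "E e = X' ?q e" if "e \<bullet> N ?q = 0" for e
      using derivative_unique_on_tangent_space[OF E _ tan[OF that]] by blast
    have "divergence X' ?q = X' ?q e1 \<bullet> e1 + X' ?q e2 \<bullet> e2 + X' ?q (N ?q) \<bullet> N ?q"
      by (rule divergence_orthonormal_frame[where X' = X', OF e(1-3) e(6) m C1_onD(5)[OF X qV]])
    also have "X' ?q (N ?q) \<bullet> N ?q = 0"
      using C1_on_unit_field[OF X unit qV] XN[OF q] by simp
    also have "X' ?q e1 \<bullet> e1 + X' ?q e2 \<bullet> e2 + 0 = - (N ?q \<bullet> v + lam)"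
      using H[OF tan[OF e(4)] tan[OF e(5)] e(1-3)] EX[OF e(4)] EX[OF e(5)] by simp
    finally have "divergence X' ?q = - (N ?q \<bullet> v + lam)" .
    moreover have "divergence X' ?q = divergence X' p" "X p = X ?q"
      using proj[OF pU] proj0[OF pU] by (auto simp: divergence_def X'_def X_def)
    ultimately show ?thesis using XN[OF q] by simp
  qed
  have UV: "U \<subseteq> V" using cyl by (force simp: cylinder_def)
  have "continuous_on U (\<lambda>x. divergence X' x + X x \<bullet> v + lam)"
    unfolding divergence_def
    using continuous_on_subset[OF C1_onD(3)[OF X] UV] continuous_on_subset[OF C1_onD(4)[OF X] UV]
    by (intro continuous_intros)
  then have divU: "divergence X' p + X p \<bullet> v + lam = 0" if "p \<in> U" for p
    using continuous_constant_on_closure[of D "\<lambda>x. divergence X' x + X x \<bullet> v + lam" 0 p] divD that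
    by (simp add: D(3))
  have "divergence X' x = - (X x \<bullet> v + lam)" if "x \<in> cylinder v U" for x
  proof -
    obtain p t where p: "p \<in> U" "x = p + t *\<^sub>R v" using \<open>x \<in> cylinder v U\<close> by (auto simp: cylinder_def)
    have "divergence X' x = divergence X' p" "X x = X p"
      using proj[OF p(1)] proj0[OF p(1)] p(2) by (auto simp: divergence_def X'_def X_def)
    then show ?thesis using divU[OF p(1)] by simp
  qed
  then show ?thesis using X cyl unit XN Nv by blast
qed

text \<open>Two graph points with equal coordinates have base points that differ by a multiple of
  \<open>v\<close>, and base points lie in one plane orthogonal to \<open>v\<close>.\<close>

lemma plane_coords_inj_on_graph:
  assumes e: "e1 \<bullet> v = 0" "e2 \<bullet> v = 0" "cross3 e1 e2 = v"
  shows "inj_on (plane_coords e1 e2) S"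
proof (rule inj_onI)
  fix x y assume xy: "x \<in> S" "y \<in> S" and eq: "plane_coords e1 e2 x = plane_coords e1 e2 y"
  obtain p q where p: "p \<in> U" "x = lift p" and q: "q \<in> U" "y = lift q" using xy S by blast
  let ?d = "p - q"
  have dv: "?d \<bullet> v = 0" using domain_in_plane p(1) q(1) by (simp add: inner_diff_left)
  have "x \<bullet> e1 = y \<bullet> e1" "x \<bullet> e2 = y \<bullet> e2"
    using eq by (simp_all add: plane_coords_def vec_eq_iff forall_2)
  then have "?d \<bullet> e1 = 0" "?d \<bullet> e2 = 0"
    using e(1,2) unfolding p(2) q(2)
    by (simp_all add: inner_diff_left inner_add_left inner_commute[of v])
  then have "cross3 ?d v = 0" unfolding e(3)[symmetric] by (simp add: Lagrange)
  then have "?d = 0" using norm_cross_dot[of ?d v] dv v by simp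
  then show "x = y" using p q by simp
qed

end

section \<open>The weighted calibration\<close>

lemma C1_on_weighted_field:
  fixes v :: "real^3"
  assumes X: "C1_on V X X'"
  shows "C1_on V (\<lambda>x. exp (x \<bullet> v) *\<^sub>R X x) (\<lambda>x h. exp (x \<bullet> v) *\<^sub>R X' x h + (exp (x \<bullet> v) * (h \<bullet> v)) *\<^sub>R X x)"
    (is "C1_on V ?Y ?Y'")
    and "divergence (\<lambda>x h. exp (x \<bullet> v) *\<^sub>R X' x h + (exp (x \<bullet> v) * (h \<bullet> v)) *\<^sub>R X x) x
      = exp (x \<bullet> v) * (divergence X' x + X x \<bullet> v)"
proof -
  have "C1_on V (\<lambda>x. exp (x \<bullet> v)) (\<lambda>x h. exp (x \<bullet> v) * (h \<bullet> v))"
    using C1_onD(1)[OF X] unfolding C1_on_def by (auto intro!: derivative_eq_intros continuous_intros)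
  from bounded_bilinear.C1_on[OF bounded_bilinear_scaleR this X] show "C1_on V ?Y ?Y'" .
  show "divergence ?Y' x = exp (x \<bullet> v) * (divergence X' x + X x \<bullet> v)"
    by (simp add: divergence_def sum_3 inner_axis' inner_vec_def[of "X x" v] algebra_simps)
qed

theorem theorem3p4:
  fixes v :: "real^3" and lam c :: real and U S :: "(real^3) set" and N :: "real^3 \<Rightarrow> real^3"
  assumes "norm v = 1"
    and "closed_plane_domain v c U"
    and "compact S"
    and "translating_soliton v lam S N"
    and "is_graph_on v U S"
  shows "\<forall>S' N'. competitor v U S N S' N' \<longrightarrow> weighted_area v S \<le> weighted_area v S'"
proof (intro allI impI)
  fix S' N' assume comp: "competitor v U S N S' N'"
  note v = assms(1)
  obtain D where D: "openin (top_of_set {x. x \<bullet> v = c}) D" "connected D" "U = closure D"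
    using assms(2) unfolding closed_plane_domain_def by blast
  obtain u where u: "smooth_on U u" "S = (\<lambda>p. p + u p *\<^sub>R v) ` U"
    using assms(5) unfolding is_graph_on_def by blast
  obtain W g g' g'' where W: "U \<subseteq> W" and g: "C1_on W g g'" "\<And>h. C1_on W (\<lambda>x. g' x h) (\<lambda>x. g'' x h)"
    and gu: "\<And>p. p \<in> U \<Longrightarrow> g p = u p"
    using smooth_on_imp_C1_extension[OF u(1)] by blast
  have S: "S = (\<lambda>p. p + g p *\<^sub>R v) ` U" unfolding u(2) by (intro image_cong) (simp_all add: gu)
  have N: "oriented_surface S N" and H: "\<And>p. p \<in> S \<Longrightarrow> has_mean_curvature S N p (N p \<bullet> v + lam)"
    using assms(4) by (auto simp: translating_soliton_def)
  note graph = v D g W S N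
  obtain V X X' where X: "C1_on V X X'" "cylinder v U \<subseteq> V" "\<And>x. x \<in> V \<Longrightarrow> norm (X x) = 1"
    "\<And>p. p \<in> S \<Longrightarrow> X p = N p" "\<And>p. p \<in> S \<Longrightarrow> N p \<bullet> v \<noteq> 0"
    "\<And>x. x \<in> cylinder v U \<Longrightarrow> divergence X' x = - (X x \<bullet> v + lam)"
    using translated_gauss_map[OF graph H] by blast
  define Y where "Y x = exp (x \<bullet> v) *\<^sub>R X x" for x
  define Y' where "Y' x h = exp (x \<bullet> v) *\<^sub>R X' x h + (exp (x \<bullet> v) * (h \<bullet> v)) *\<^sub>R X x" for x h
  have Y: "C1_on V Y Y'" unfolding Y_def Y'_def by (rule C1_on_weighted_field[OF X(1)])
  have divY: "divergence Y' x = - lam * exp (x \<bullet> v)" if "x \<in> cylinder v U" for x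
  proof -
    have "divergence Y' x = exp (x \<bullet> v) * (divergence X' x + X x \<bullet> v)"
      unfolding Y'_def[abs_def] by (rule C1_on_weighted_field(2)[OF X(1)])
    then show ?thesis unfolding X(6)[OF that] by simp
  qed
  have S': "oriented_surface S' N'" "S' \<subseteq> cylinder v U" using comp by (auto simp: competitor_def)
  obtain \<Omega> s s' where \<Omega>: "smooth_3_chain (cylinder v U) \<Omega>" "chain_boundary 3 \<Omega> = s - s'" "weighted_volume v \<Omega> = 0"
    and s: "fundamental_chain S N s" and s': "fundamental_chain S' N' s'"
    using comp unfolding competitor_def bounds_3_chain_def by blast
  let ?j = "\<lambda>\<sigma> y. det (matrix (frechet_derivative (\<sigma> \<circ> bary3) (at y)))"
  \<comment> \<open>this is where the volume constraint enters: the flux difference is proportional to the volume\<close>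
  have "chain_sum (flux Y) s - chain_sum (flux Y) s' = - lam * weighted_volume v \<Omega>"
  proof -
    have "chain_sum (flux Y) s - chain_sum (flux Y) s'
      = chain_sum (\<lambda>\<sigma>. integral (interior solid_simplex3) (\<lambda>y. divergence Y' (\<sigma> (bary3 y)) * ?j \<sigma> y)) \<Omega>"
      using stokes_smooth_chain[OF \<Omega>(1) Y X(2)] by (simp add: \<Omega>(2) chain_sum_diff)
    also have "\<dots> = - lam * weighted_volume v \<Omega>"
      unfolding chain_sum_def weighted_volume_def sum_distrib_left
    proof (rule sum.cong[OF refl])
      fix \<sigma> assume "\<sigma> \<in> Poly_Mapping.keys \<Omega>"
      then have "singular_simplex 3 (top_of_set (cylinder v U)) \<sigma>"
        using \<Omega>(1) by (auto simp: smooth_3_chain_def singular_chain_def)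
      then have in_cyl: "\<sigma> (bary3 y) \<in> cylinder v U" if "y \<in> interior solid_simplex3" for y
        using subsetD[OF interior_subset that]
        by (auto simp: singular_simplex_def continuous_map_def topspace_standard_simplex Pi_iff solid_simplex3_def)
      have "integral (interior solid_simplex3) (\<lambda>y. divergence Y' (\<sigma> (bary3 y)) * ?j \<sigma> y)
        = integral (interior solid_simplex3) (\<lambda>y. - lam * (exp (\<sigma> (bary3 y) \<bullet> v) * ?j \<sigma> y))"
        by (rule integral_cong) (simp add: divY in_cyl)
      also have "\<dots> = - lam * integral (interior solid_simplex3) (\<lambda>y. exp (\<sigma> (bary3 y) \<bullet> v) * ?j \<sigma> y)"
        by (rule integral_mult_right)
      finally show "of_int (Poly_Mapping.lookup \<Omega> \<sigma>) *
          integral (interior solid_simplex3) (\<lambda>y. divergence Y' (\<sigma> (bary3 y)) * ?j \<sigma> y)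
        = - lam * (of_int (Poly_Mapping.lookup \<Omega> \<sigma>) *
          integral (interior solid_simplex3) (\<lambda>y. exp (\<sigma> (bary3 y) \<bullet> v) * ?j \<sigma> y))"
        by simp
    qed
    finally show ?thesis .
  qed
  with \<Omega>(3) have flux_eq: "chain_sum (flux Y) s = chain_sum (flux Y) s'" by simp
  have f: "continuous_on A (\<lambda>x. exp (x \<bullet> v))" for A by (intro continuous_intros)
  have unitN: "\<forall>p\<in>S. norm (N p) = 1" "continuous_on S N" and unitN': "\<forall>p\<in>S'. norm (N' p) = 1" "continuous_on S' N'"
    using N S'(1) by (auto simp: oriented_surface_def)
  obtain e1 e2 where e: "e1 \<bullet> v = 0" "e2 \<bullet> v = 0" "cross3 e1 e2 = v"
    using orthonormal_frame[OF v] by metis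
  have "weighted_area v S \<le> ennreal (chain_sum (flux Y) s)"
    unfolding weighted_area_def
  proof (rule surface_integral_le_chain_flux[OF s unitN assms(3) plane_coords_inj_on_graph[OF graph e] N])
    show "N p \<bullet> cross3 e1 e2 \<noteq> 0" if "p \<in> S" for p using X(5)[OF that] e(3) by simp
    show "Y p \<bullet> N p = exp (p \<bullet> v)" if "p \<in> S" for p
      using X(4)[OF that] unitN(1) that by (simp add: Y_def norm_eq_1)
  qed (auto intro: f)
  also have "\<dots> = ennreal (chain_sum (flux Y) s')" by (simp only: flux_eq)
  also have "\<dots> \<le> weighted_area v S'"
    unfolding weighted_area_def
  proof (rule chain_flux_le_surface_integral[OF s' unitN'])
    have "S' \<subseteq> V" using S'(2) X(2) by blast
    then show "continuous_on S' Y" by (rule continuous_on_subset[OF C1_onD(4)[OF Y]])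
    show "Y p \<bullet> N' p \<le> exp (p \<bullet> v)" if p: "p \<in> S'" for p
    proof -
      have "X p \<bullet> N' p \<le> norm (X p) * norm (N' p)" by (rule norm_cauchy_schwarz)
      also have "\<dots> = 1" using X(3) \<open>S' \<subseteq> V\<close> unitN'(1) p by auto
      finally show ?thesis by (simp add: Y_def mult_left_le)
    qed
  qed (auto intro: f)
  finally show "weighted_area v S \<le> weighted_area v S'" .
qed

end
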